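(* Let $(W,S)$ be of type $A_n$, so that $W=\mathfrak{S}_{n+1}$ and its Artin–Tits group is the braid group $\mathcal{B}_{n+1}$ on $n+1$ strands. Let $\beta\in\mathcal{B}_{n+1}$. Then $\beta$ is a Mikado braid if and only if $\beta=\mathbf{x}^{-1}\mathbf{y}$ for some $\mathbf{x},\mathbf{y}\in\mathbf{W}$; hence $\beta$ is a Mikado braid if and only if $\beta$ is a rational permutation braid.
   Context: $S=\{s_1,\ldots,s_n\}$ with $s_i=(i,i+1)$; $\mathcal{B}_{n+1}$ is generated by $\mathbf{s}_1,\ldots,\mathbf{s}_n$ with the braid relations, and $B^+(W)$ is the submonoid generated by the $\mathbf{s}_i$. $\mathbf{W}\subset B^+(W)$ is the positive lift of $W$: the set of elements $\mathbf{w}=\mathbf{s}_{i_1}\cdots\mathbf{s}_{i_k}$ with $s_{i_1}\cdots s_{i_k}$ a reduced expression of $w\in W$. $\Delta$ is the lift of the longest element of $W$. Write $u\preccurlyeq v$ if $u^{-1}v\in B^+(W)$; a rational permutation braid is an element $\beta$ with $\Delta^{-1}\preccurlyeq\beta\preccurlyeq\Delta$. Elements of $\mathcal{B}_{n+1}$ are represented by usual (Artin) braid diagrams, read from top to bottom, with the convention that in a reduced diagram of an element of $\mathbf{W}$ the strand starting at the $i$-th point passes above the strands starting at points $1,\ldots,i-1$ that it crosses. A braid diagram of a braid is reduced if it has the minimal number of crossings among diagrams of that braid. A strand of a reduced diagram is good if it is over all the other strands that it crosses. Mikado braids are defined recursively: the trivial braid $e\in\mathcal{B}_1$ is a Mikado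 braid; a braid $\beta\in\mathcal{B}_{n+1}$ is a Mikado braid if in any reduced diagram for $\beta$ there exists at least one good strand and removing any such strand yields a Mikado braid in $\mathcal{B}_n$. *)

theory Defs
  imports "HOL-Algebra.Sym_Groups"
begin

text \<open>
  Throughout, \<open>m\<close> is the number of strands, so type \<open>A\<^sub>n\<close> corresponds to \<open>m = n + 1\<close> and the
  generators are indexed by \<open>{1..<m} = {1..n}\<close>.

  A generic Artin braid diagram on \<open>m\<close> strands (crossings at pairwise distinct heights), taken up to
  planar isotopy preserving the heights' order, is the word of its crossings read from top to bottom.
  The letter \<open>(i, e)\<close> is a crossing between the strands currently at positions \<open>i\<close> and \<open>i + 1\<close>;
  it stands for the generator \<open>s\<^sub>i\<close> if \<open>e\<close> is true and for its inverse otherwise.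
\<close>

type_synonym crossing = "nat \<times> bool"
type_synonym diagram = "crossing list"
type_synonym braid = "diagram set"

definition diagrams :: "nat \<Rightarrow> diagram set" where
  "diagrams m = lists ({1..<m} \<times> UNIV)"

inductive_set braid_rel :: "nat \<Rightarrow> (diagram \<times> diagram) set" for m :: nat where
  refl: "u \<in> diagrams m \<Longrightarrow> (u, u) \<in> braid_rel m"
| sym: "(u, v) \<in> braid_rel m \<Longrightarrow> (v, u) \<in> braid_rel m"
| trans: "(u, v) \<in> braid_rel m \<Longrightarrow> (v, w) \<in> braid_rel m \<Longrightarrow> (u, w) \<in> braid_rel m"
| cancel: "u \<in> diagrams m \<Longrightarrow> v \<in> diagrams m \<Longrightarrow> i \<in> {1..<m} \<Longrightarrow>
    (u @ [(i, e), (i, \<not> e)] @ v, u @ v) \<in> braid_rel m"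
| far: "u \<in> diagrams m \<Longrightarrow> v \<in> diagrams m \<Longrightarrow> i \<in> {1..<m} \<Longrightarrow> j \<in> {1..<m} \<Longrightarrow> i + 2 \<le> j \<Longrightarrow>
    (u @ [(i, True), (j, True)] @ v, u @ [(j, True), (i, True)] @ v) \<in> braid_rel m"
| braid: "u \<in> diagrams m \<Longrightarrow> v \<in> diagrams m \<Longrightarrow> i \<in> {1..<m} \<Longrightarrow> i + 1 \<in> {1..<m} \<Longrightarrow>
    (u @ [(i, True), (i + 1, True), (i, True)] @ v,
     u @ [(i + 1, True), (i, True), (i + 1, True)] @ v) \<in> braid_rel m"

definition braid_of :: "nat \<Rightarrow> diagram \<Rightarrow> braid" where
  "braid_of m D = braid_rel m `` {D}"

text \<open>The elements of the braid group are the equivalence classes of diagrams, so that the diagrams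
  of a braid \<open>\<beta>\<close> are the members of \<open>\<beta>\<close>.\<close>

definition braid_group :: "nat \<Rightarrow> braid monoid" where
  "braid_group m =
     \<lparr>carrier = diagrams m // braid_rel m,
      mult = (\<lambda>a b. \<Union>u\<in>a. \<Union>v\<in>b. braid_of m (u @ v)),
      one = braid_of m []\<rparr>"

definition sigma :: "nat \<Rightarrow> nat \<Rightarrow> braid" where
  "sigma m i = braid_of m [(i, True)]"

subsection \<open>The braid group is a group\<close>

lemma diagrams_append [simp]: "u @ v \<in> diagrams m \<longleftrightarrow> u \<in> diagrams m \<and> v \<in> diagrams m"
  by (auto simp: diagrams_def)

lemma diagrams_Nil [simp]: "[] \<in> diagrams m"
  by (simp add: diagrams_def)

lemma diagrams_Cons [simp]: "(i, e) # u \<in> diagrams m \<longleftrightarrow> i \<in> {1..<m} \<and> u \<in> diagrams m"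
  by (auto simp: diagrams_def)

lemma braid_rel_diagrams: "(u, v) \<in> braid_rel m \<Longrightarrow> u \<in> diagrams m \<and> v \<in> diagrams m"
  by (induction rule: braid_rel.induct) auto

lemma equiv_braid_rel: "equiv (diagrams m) (braid_rel m)"
proof (rule equivI)
  show "braid_rel m \<subseteq> diagrams m \<times> diagrams m" by (auto dest: braid_rel_diagrams)
  show "refl_on (diagrams m) (braid_rel m)" by (rule refl_onI) (rule braid_rel.refl)
  show "sym (braid_rel m)" by (rule symI) (rule braid_rel.sym)
  show "trans (braid_rel m)" by (rule transI) (rule braid_rel.trans)
qed

lemma braid_rel_ctxt:
  assumes "(u, v) \<in> braid_rel m" "p \<in> diagrams m" "q \<in> diagrams m"
  shows "(p @ u @ q, p @ v @ q) \<in> braid_rel m"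
  using assms
proof (induction rule: braid_rel.induct)
  case (cancel u v i e)
  then show ?case using braid_rel.cancel[of "p @ u" m "v @ q" i e] by simp
next
  case (far u v i j)
  then show ?case using braid_rel.far[of "p @ u" m "v @ q" i j] by simp
next
  case (braid u v i)
  then show ?case using braid_rel.braid[of "p @ u" m "v @ q" i] by simp
qed (simp_all add: braid_rel.refl, blast intro: braid_rel.sym, blast intro: braid_rel.trans)

lemma braid_rel_append:
  assumes "(u, u') \<in> braid_rel m" "(v, v') \<in> braid_rel m"
  shows "(u @ v, u' @ v') \<in> braid_rel m"
proof -
  have "(u @ v, u' @ v) \<in> braid_rel m"
    using braid_rel_ctxt[OF assms(1), of "[]" v] braid_rel_diagrams[OF assms(2)] by simp
  moreover have "(u' @ v, u' @ v') \<in> braid_rel m"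
    using braid_rel_ctxt[OF assms(2), of u' "[]"] braid_rel_diagrams[OF assms(1)] by simp
  ultimately show ?thesis by (rule braid_rel.trans)
qed

lemma braid_of_eqI: "(u, v) \<in> braid_rel m \<Longrightarrow> braid_of m u = braid_of m v"
  unfolding braid_of_def by (rule equiv_class_eq[OF equiv_braid_rel])

lemma braid_group_mult:
  assumes "u \<in> diagrams m" "v \<in> diagrams m"
  shows "braid_of m u \<otimes>\<^bsub>braid_group m\<^esub> braid_of m v = braid_of m (u @ v)"
proof -
  have ne: "u \<in> braid_of m u" "v \<in> braid_of m v"
    using assms by (auto simp: braid_of_def intro: braid_rel.refl)
  have eq: "braid_of m (u' @ v') = braid_of m (u @ v)"
    if "u' \<in> braid_of m u" "v' \<in> braid_of m v" for u' v'
  proof -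
    have "(u, u') \<in> braid_rel m" "(v, v') \<in> braid_rel m"
      using that by (simp_all add: braid_of_def)
    then show ?thesis by (metis braid_of_eqI braid_rel_append)
  qed
  have "(\<Union>u'\<in>braid_of m u. \<Union>v'\<in>braid_of m v. braid_of m (u' @ v')) =
        (\<Union>u'\<in>braid_of m u. \<Union>v'\<in>braid_of m v. braid_of m (u @ v))"
    by (intro SUP_cong HOL.refl eq)
  also have "\<dots> = braid_of m (u @ v)" using ne by blast
  finally show ?thesis by (simp add: braid_group_def)
qed

lemma braid_group_carrier: "carrier (braid_group m) = braid_of m ` diagrams m"
  by (auto simp: braid_group_def braid_of_def quotient_def)

lemma braid_inverse:
  assumes "u \<in> diagrams m"
  shows "rev (map (apsnd Not) u) \<in> diagrams m \<and> (rev (map (apsnd Not) u) @ u, []) \<in> braid_rel m"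
  using assms
proof (induction u)
  case Nil
  then show ?case by (auto intro: braid_rel.refl)
next
  case (Cons c u)
  obtain i e where c: "c = (i, e)" by force
  with Cons have i: "i \<in> {1..<m}" and u: "u \<in> diagrams m" by auto
  let ?u' = "rev (map (apsnd Not) u)"
  have u': "?u' \<in> diagrams m" "(?u' @ u, []) \<in> braid_rel m" using Cons.IH[OF u] by auto
  have "(?u' @ [(i, \<not> e), (i, e)] @ u, ?u' @ u) \<in> braid_rel m"
    using braid_rel.cancel[OF u'(1) u i, of "\<not> e"] by simp
  then have "(?u' @ [(i, \<not> e), (i, e)] @ u, []) \<in> braid_rel m"
    using u'(2) by (rule braid_rel.trans)
  then show ?case using u'(1) i by (simp add: c)
qed

lemma group_braid_group: "group (braid_group m)"
proof (rule groupI)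
  show "\<one>\<^bsub>braid_group m\<^esub> \<in> carrier (braid_group m)"
    unfolding braid_group_carrier by (auto simp: braid_group_def)
next
  fix a assume "a \<in> carrier (braid_group m)"
  then obtain u where u: "u \<in> diagrams m" "a = braid_of m u"
    by (auto simp: braid_group_carrier)
  have one: "\<one>\<^bsub>braid_group m\<^esub> = braid_of m []" by (simp add: braid_group_def)
  show "\<one>\<^bsub>braid_group m\<^esub> \<otimes>\<^bsub>braid_group m\<^esub> a = a"
    using u by (simp add: one braid_group_mult)
  show "\<exists>b\<in>carrier (braid_group m). b \<otimes>\<^bsub>braid_group m\<^esub> a = \<one>\<^bsub>braid_group m\<^esub>"
  proof
    show "braid_of m (rev (map (apsnd Not) u)) \<in> carrier (braid_group m)"
      using braid_inverse[OF u(1)] by (simp add: braid_group_carrier)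
    show "braid_of m (rev (map (apsnd Not) u)) \<otimes>\<^bsub>braid_group m\<^esub> a = \<one>\<^bsub>braid_group m\<^esub>"
      using braid_inverse[OF u(1)] u by (simp add: one braid_group_mult braid_of_eqI)
  qed
qed (auto simp: braid_group_carrier braid_group_mult)

subsection \<open>Reduced expressions and positive lifts\<close>

text \<open>The product \<open>g i\<^sub>1 \<cdots> g i\<^sub>k\<close> in \<open>G\<close>.\<close>

definition word_prod :: "('g, 'b) monoid_scheme \<Rightarrow> (nat \<Rightarrow> 'g) \<Rightarrow> nat list \<Rightarrow> 'g" where
  "word_prod G g is = foldr (\<lambda>i x. g i \<otimes>\<^bsub>G\<^esub> x) is \<one>\<^bsub>G\<^esub>"

text \<open>The Coxeter group \<open>W\<close> is \<^term>\<open>sym_group m\<close>, with \<open>s\<^sub>i\<close> the transposition \<open>(i, i + 1)\<close>.\<close>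

definition expression :: "nat \<Rightarrow> nat list \<Rightarrow> (nat \<Rightarrow> nat) \<Rightarrow> bool" where
  "expression m is w \<longleftrightarrow>
     set is \<subseteq> {1..<m} \<and> word_prod (sym_group m) (\<lambda>i. transpose i (i + 1)) is = w"

definition perm_length :: "nat \<Rightarrow> (nat \<Rightarrow> nat) \<Rightarrow> nat" where
  "perm_length m w = (LEAST k. \<exists>is. expression m is w \<and> length is = k)"

definition reduced_expression :: "nat \<Rightarrow> nat list \<Rightarrow> (nat \<Rightarrow> nat) \<Rightarrow> bool" where
  "reduced_expression m is w \<longleftrightarrow> expression m is w \<and> length is = perm_length m w"

definition positive_lifts :: "nat \<Rightarrow> braid set" where
  "positive_lifts m =
     {word_prod (braid_group m) (sigma m) is | is w.
        w \<in> carrier (sym_group m) \<and> reduced_expression m is w}"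

text \<open>By Matsumoto's theorem the choice of the reduced expression is irrelevant.\<close>

definition lift :: "nat \<Rightarrow> (nat \<Rightarrow> nat) \<Rightarrow> braid" where
  "lift m w = word_prod (braid_group m) (sigma m) (SOME is. reduced_expression m is w)"

definition longest_element :: "nat \<Rightarrow> nat \<Rightarrow> nat" where
  "longest_element m = (ARG_MAX (perm_length m) w. w \<in> carrier (sym_group m))"

definition Delta :: "nat \<Rightarrow> braid" where
  "Delta m = lift m (longest_element m)"

subsection \<open>Rational permutation braids\<close>

inductive_set positive_monoid :: "nat \<Rightarrow> braid set" for m :: nat where
  one: "\<one>\<^bsub>braid_group m\<^esub> \<in> positive_monoid m"
| gen: "i \<in> {1..<m} \<Longrightarrow> sigma m i \<in> positive_monoid m"
| mult: "a \<in> positive_monoid m \<Longrightarrow> b \<in> positive_monoid m \<Longrightarrow>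
    a \<otimes>\<^bsub>braid_group m\<^esub> b \<in> positive_monoid m"

definition left_divides :: "nat \<Rightarrow> braid \<Rightarrow> braid \<Rightarrow> bool" where
  "left_divides m u v \<longleftrightarrow> inv\<^bsub>braid_group m\<^esub> u \<otimes>\<^bsub>braid_group m\<^esub> v \<in> positive_monoid m"

definition rational_permutation_braid :: "nat \<Rightarrow> braid \<Rightarrow> bool" where
  "rational_permutation_braid m \<beta> \<longleftrightarrow>
     \<beta> \<in> carrier (braid_group m) \<and>
     left_divides m (inv\<^bsub>braid_group m\<^esub> (Delta m)) \<beta> \<and> left_divides m \<beta> (Delta m)"

subsection \<open>Strands and Mikado braids\<close>

definition reduced_diagram :: "diagram \<Rightarrow> braid \<Rightarrow> bool" where
  "reduced_diagram D \<beta> \<longleftrightarrow> D \<in> \<beta> \<and> (\<forall>E\<in>\<beta>. length D \<le> length E)"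

text \<open>
  Strands are named by their starting point. In the next two functions \<open>p\<close> is the current position
  of one strand, which the crossing \<open>(i, e)\<close> moves to \<open>transpose i (i + 1) p\<close>.

  In \<open>s\<^sub>i\<close> the strand starting at \<open>i + 1\<close> passes above the one starting at \<open>i\<close>. In the inverse, which
  is the image of \<open>s\<^sub>i\<close> under the reflection in a horizontal line, the strand starting at \<open>i\<close> passes
  above the one starting at \<open>i + 1\<close>.
\<close>

fun over_all :: "nat \<Rightarrow> diagram \<Rightarrow> bool" where
  "over_all p [] \<longleftrightarrow> True"
| "over_all p ((i, e) # D) \<longleftrightarrow>
     p \<noteq> (if e then i else i + 1) \<and> over_all (transpose i (i + 1) p) D"

definition good_strand :: "nat \<Rightarrow> diagram \<Rightarrow> nat \<Rightarrow> bool" where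
  "good_strand m D p \<longleftrightarrow> p \<in> {1..m} \<and> over_all p D"

text \<open>Crossings to the right of the removed strand move one position to the left.\<close>

fun remove_strand :: "nat \<Rightarrow> diagram \<Rightarrow> diagram" where
  "remove_strand p [] = []"
| "remove_strand p ((i, e) # D) =
     (let D' = remove_strand (transpose i (i + 1) p) D
      in if p = i \<or> p = i + 1 then D' else (if p < i then i - 1 else i, e) # D')"

inductive mikado :: "nat \<Rightarrow> braid \<Rightarrow> bool" where
  trivial: "mikado 1 \<one>\<^bsub>braid_group 1\<^esub>"
| step: "\<beta> \<in> carrier (braid_group (m + 1)) \<Longrightarrow>
    (\<And>D. reduced_diagram D \<beta> \<Longrightarrow>
      (\<exists>p. good_strand (m + 1) D p) \<and>
      (\<forall>p. good_strand (m + 1) D p \<longrightarrow> mikado m (braid_of m (remove_strand p D)))) \<Longrightarrow>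
    mikado (m + 1) \<beta>"

end

theory Submission
  imports Defs
begin

text \<open>
  A strand \<open>p\<close> that is over all others can be pulled on top to the last position, kept there while
  the remaining strands do their braid, and sent back. So a braid with a good strand is
  \<open>c\<^sub>p\<inverse> \<beta>' c\<^sub>q\<close> with \<open>c\<^sub>p\<close>, \<open>c\<^sub>q\<close> minimal coset representatives, and Mikado braids are fractions
  \<open>x\<inverse> y\<close> by induction.

  Conversely, inserting the strands of \<open>x\<inverse> y\<close> one by one, from the lowest to the highest, as straight
  as possible gives a diagram in which any two strands cross at most once and whose last inserted
  strand is good. The signed number of crossings of \<open>p\<close> over \<open>q\<close> is an invariant of the braid, so any
  reduced diagram has the same numbers of crossings of \<open>p\<close> over \<open>q\<close>, and therefore the same good strands.

  If \<open>\<beta>\<close> is rational, then \<open>a = \<Delta>\<beta>\<close> and \<open>c = \<beta>\<inverse>\<Delta>\<close> are positive with \<open>ac = \<Delta>\<^sup>2\<close>, so that any two strands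
  cross exactly twice in \<open>ac\<close>. This alone forces \<open>a\<close> to be a product of two permutation braids, which
  is shown by adding its letters to a left-weighted factorization: a letter that does not fit yields
  three or four strands whose remaining crossings in \<open>c\<close> are impossible for reasons of order.
\<close>

section \<open>Crossings of two strands\<close>

abbreviation adj :: "nat \<Rightarrow> nat \<Rightarrow> nat" where
  "adj i \<equiv> transpose i (Suc i)"

lemma adj_inj [simp]: "adj i p = adj i q \<longleftrightarrow> p = q"
  by (metis transpose_involutory)

fun dest :: "diagram \<Rightarrow> nat \<Rightarrow> nat" where
  "dest [] p = p"
| "dest ((i, e) # D) p = dest D (adj i p)"

fun overs :: "nat \<Rightarrow> nat \<Rightarrow> diagram \<Rightarrow> nat" where
  "overs p q [] = 0"
| "overs p q ((i, e) # D) =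
     (if p = (if e then Suc i else i) \<and> q = (if e then i else Suc i) then 1 else 0)
     + overs (adj i p) (adj i q) D"

text \<open>An ordered linking number: unlike the symmetric one it keeps apart which of the two
  strands is above, and this makes good strands visible to an invariant of the braid.\<close>

fun signed_overs :: "nat \<Rightarrow> nat \<Rightarrow> diagram \<Rightarrow> int" where
  "signed_overs p q [] = 0"
| "signed_overs p q ((i, e) # D) =
     (if p = (if e then Suc i else i) \<and> q = (if e then i else Suc i) then (if e then 1 else - 1) else 0)
     + signed_overs (adj i p) (adj i q) D"

definition crossings :: "nat \<Rightarrow> nat \<Rightarrow> diagram \<Rightarrow> nat" where
  "crossings p q D = overs p q D + overs q p D"

text \<open>For positive words this is the geometric form of being reduced;
  \<open>reduced_expression_iff\<close> makes the connection with Coxeter length.\<close>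

definition simple :: "diagram \<Rightarrow> bool" where
  "simple D \<longleftrightarrow> (\<forall>p q. p \<noteq> q \<longrightarrow> crossings p q D \<le> 1)"

definition dinv :: "diagram \<Rightarrow> diagram" where
  "dinv D = rev (map (apsnd Not) D)"

definition positive :: "diagram \<Rightarrow> bool" where
  "positive D \<longleftrightarrow> (\<forall>c\<in>set D. snd c)"

lemma positive_simps [simp]:
  "positive []" "positive (c # D) \<longleftrightarrow> snd c \<and> positive D"
  "positive (D @ E) \<longleftrightarrow> positive D \<and> positive E" "positive (rev D) \<longleftrightarrow> positive D"
  by (auto simp: positive_def)

lemma crossings_Nil [simp]: "crossings p q [] = 0"
  by (simp add: crossings_def)

lemma crossings_Cons:
  "crossings p q ((i, e) # D) =
    (if p = i \<and> q = Suc i \<or> p = Suc i \<and> q = i then 1 else 0) + crossings (adj i p) (adj i q) D"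
  by (auto simp: crossings_def)

lemma crossings_commute: "crossings p q D = crossings q p D"
  by (simp add: crossings_def)

lemma dest_append [simp]: "dest (D @ E) p = dest E (dest D p)"
  by (induction D p rule: dest.induct) auto

lemma overs_append: "overs p q (D @ E) = overs p q D + overs (dest D p) (dest D q) E"
  by (induction p q D rule: overs.induct) auto

lemma signed_overs_append: "signed_overs p q (D @ E) = signed_overs p q D + signed_overs (dest D p) (dest D q) E"
  by (induction p q D rule: signed_overs.induct) auto

lemma crossings_append: "crossings p q (D @ E) = crossings p q D + crossings (dest D p) (dest D q) E"
  by (simp add: crossings_def overs_append)

lemma dest_inj [simp]: "dest D p = dest D q \<longleftrightarrow> p = q"
  by (induction D p arbitrary: q rule: dest.induct) auto

lemma overs_same [simp]: "overs p p D = 0"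
  by (induction D arbitrary: p) auto

lemma dest_mem:
  "D \<in> diagrams m \<Longrightarrow> dest D p \<in> {1..m} \<longleftrightarrow> p \<in> {1..m}"
proof (induction D p rule: dest.induct)
  case (2 i e D p)
  then have "i \<in> {1..<m}" "D \<in> diagrams m" by auto
  then show ?case using 2 by (auto simp: transpose_def)
qed auto

lemma dest_bounds:
  "D \<in> diagrams m \<Longrightarrow> Suc 0 \<le> p \<Longrightarrow> p \<le> m \<Longrightarrow> Suc 0 \<le> dest D p"
  "D \<in> diagrams m \<Longrightarrow> Suc 0 \<le> p \<Longrightarrow> p \<le> m \<Longrightarrow> dest D p \<le> m"
  using dest_mem[of D m p] by auto

lemma dest_dinv1: "dest (dinv D) (dest D p) = p"
  by (induction D p rule: dest.induct) (auto simp: dinv_def)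

lemma dinv_dinv [simp]: "dinv (dinv D) = D"
  by (simp add: dinv_def rev_map o_def apsnd_def map_prod_def case_prod_unfold)

lemma dest_dinv2 [simp]: "dest D (dest (dinv D) p) = p"
  using dest_dinv1[of "dinv D" p] by simp

declare dest_dinv1 [simp]

lemma dinv_append: "dinv (u @ v) = dinv v @ dinv u"
  by (simp add: dinv_def)

lemma dinv_Cons: "dinv ((i, e) # u) = dinv u @ [(i, \<not> e)]"
  by (simp add: dinv_def)

lemma dinv_Nil [simp]: "dinv [] = []"
  by (simp add: dinv_def)

lemma dinv_diagrams [simp]: "dinv D \<in> diagrams m \<longleftrightarrow> D \<in> diagrams m"
  by (induction D) (auto simp: dinv_Cons)

lemma bij_betw_dest: "D \<in> diagrams m \<Longrightarrow> bij_betw (dest D) {1..m} {1..m}"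
  by (rule bij_betw_byWitness[where f' = "dest (dinv D)"]) (auto simp: dest_bounds)

lemma dest_rel: "(u, v) \<in> braid_rel m \<Longrightarrow> dest u p = dest v p"
  by (induction arbitrary: p rule: braid_rel.induct) (auto simp: transpose_def)

text \<open>A local check. In a cancelling pair the same strand is above both times, with opposite
  signs; in the other two relations the same pairs cross with the same upper strand, only in another
  order.\<close>

lemma signed_overs_rel: "(u, v) \<in> braid_rel m \<Longrightarrow> signed_overs p q u = signed_overs p q v"
proof (induction arbitrary: p q rule: braid_rel.induct)
  case (braid u v i)
  have "signed_overs a b [(i, True), (i + 1, True), (i, True)] = signed_overs a b [(i + 1, True), (i, True), (i + 1, True)]"
    for a b by (auto simp: transpose_def)
  moreover have "dest [(i, True), (i + 1, True), (i, True)] a = dest [(i + 1, True), (i, True), (i + 1, True)] a"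
    for a by (auto simp: transpose_def)
  ultimately show ?case by (simp only: signed_overs_append dest_append)
next
  case (far u v i j)
  have "signed_overs a b [(i, True), (j, True)] = signed_overs a b [(j, True), (i, True)]"
    for a b using far by (auto simp: transpose_def)
  moreover have "dest [(i, True), (j, True)] a = dest [(j, True), (i, True)] a"
    for a using far by (auto simp: transpose_def)
  ultimately show ?case by (simp only: signed_overs_append dest_append)
next
  case (cancel u v i e)
  have "signed_overs a b [(i, e), (i, \<not>e)] = 0" for a b by (auto simp: transpose_def)
  moreover have "dest [(i, e), (i, \<not>e)] a = a" for a by simp
  ultimately show ?case by (simp only: signed_overs_append dest_append)
qed auto

lemma signed_overs_positive: "positive D \<Longrightarrow> signed_overs p q D = int (overs p q D)"
  by (induction D arbitrary: p q) auto

lemma signed_overs_plus_positive: "positive D \<Longrightarrow> int (crossings p q D) = signed_overs p q D + signed_overs q p D"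
  by (simp add: crossings_def signed_overs_positive)

lemma crossings_rel_positive:
  "(u, v) \<in> braid_rel m \<Longrightarrow> positive u \<Longrightarrow> positive v \<Longrightarrow> crossings p q u = crossings p q v"
  by (metis signed_overs_plus_positive signed_overs_rel of_nat_eq_iff)

lemma abs_signed_overs_le: "\<bar>signed_overs p q D\<bar> \<le> int (overs p q D)"
proof (induction p q D rule: signed_overs.induct)
  case (2 p q i e D)
  then show ?case
    using abs_triangle_ineq[of 1 "signed_overs (adj i p) (adj i q) D"]
      abs_triangle_ineq[of "- 1" "signed_overs (adj i p) (adj i q) D"]
    by (cases e) auto
qed auto

text \<open>Only a crossing of the two strands themselves changes their relative order, and each
  such crossing reverses it.\<close>

lemma crossings_parity: "p \<noteq> q \<Longrightarrow> odd (crossings p q D) \<longleftrightarrow> (p < q) \<noteq> (dest D p < dest D q)"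
proof (induction D arbitrary: p q)
  case (Cons c D)
  obtain i e where c: "c = (i, e)" by force
  have ne: "adj i p \<noteq> adj i q" using Cons.prems by simp
  have "(adj i p < adj i q) = ((p < q) \<noteq> (p = i \<and> q = Suc i \<or> p = Suc i \<and> q = i))"
    using Cons.prems unfolding transpose_def
    by (cases "p = i"; cases "p = Suc i"; cases "q = i"; cases "q = Suc i") auto
  then show ?case using Cons.IH[OF ne] by (auto simp: c crossings_Cons)
qed auto

lemma simple_crossings_iff:
  "simple D \<Longrightarrow> p \<noteq> q \<Longrightarrow> crossings p q D = (if (p < q) = (dest D p < dest D q) then 0 else 1)"
  using crossings_parity[of p q D] unfolding simple_def
  by (metis One_nat_def even_zero le_SucE le_zero_eq odd_one)

text \<open>With at most one crossing per pair nothing can cancel, so a simple diagram attains the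
  bound of \<open>abs_signed_overs_le\<close>.\<close>

lemma simple_overs_signed_overs: "simple D \<Longrightarrow> int (overs p q D) = \<bar>signed_overs p q D\<bar>"
proof (induction p q D rule: signed_overs.induct)
  case (2 p q i e D)
  have sD: "simple D"
    unfolding simple_def
  proof (intro allI impI)
    fix a b :: nat assume "a \<noteq> b"
    then have "adj i a \<noteq> adj i b" by simp
    then have "crossings (adj i a) (adj i b) ((i, e) # D) \<le> 1"
      using 2(2) unfolding simple_def by blast
    then show "crossings a b D \<le> 1" by (simp add: crossings_Cons)
  qed
  note IH = 2(1)[OF sD]
  show ?case
  proof (cases "p = (if e then Suc i else i) \<and> q = (if e then i else Suc i)")
    case True
    then have "p \<noteq> q" by auto
    then have "crossings p q ((i, e) # D) \<le> 1" using 2(2) by (simp add: simple_def)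
    then have "overs (adj i p) (adj i q) D = 0" using True by (auto simp: crossings_Cons crossings_def split: if_splits)
    then show ?thesis using IH by (simp split: if_splits)
  next
    case False
    then show ?thesis using IH by (cases e) auto
  qed
qed auto

text \<open>Every crossing has one upper and one lower strand, so exactly one ordered pair counts
  it.\<close>

lemma length_sum_overs:
  "D \<in> diagrams m \<Longrightarrow> length D = (\<Sum>p\<in>{1..m}. \<Sum>q\<in>{1..m}. overs p q D)"
proof (induction D)
  case (Cons c D)
  obtain i e where c: "c = (i, e)" by force
  have i: "i \<in> {1..<m}" and D: "D \<in> diagrams m" using Cons.prems by (auto simp: c)
  let ?a = "if e then Suc i else i" and ?b = "if e then i else Suc i"
  \<comment> \<open>The recursion renames the strands by a transposition of \<open>{1..m}\<close>;
    reindexing shows that the double sum does not notice this.\<close>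
  have bij: "bij_betw (adj i) {1..m} {1..m}"
    using bij_betw_dest[of "[(i, e)]" m] i by (simp add: fun_eq_iff[symmetric] bij_betw_def inj_on_def image_def)
  have "(\<Sum>p\<in>{1..m}. \<Sum>q\<in>{1..m}. overs (adj i p) (adj i q) D)
      = (\<Sum>p\<in>{1..m}. \<Sum>q\<in>{1..m}. overs (adj i p) q D)"
    by (rule sum.cong[OF HOL.refl], rule sum.reindex_bij_betw[OF bij])
  also have "\<dots> = (\<Sum>p\<in>{1..m}. \<Sum>q\<in>{1..m}. overs p q D)"
    by (rule sum.reindex_bij_betw[OF bij])
  also have "\<dots> = length D" using Cons.IH D by simp
  finally have 1: "(\<Sum>p\<in>{1..m}. \<Sum>q\<in>{1..m}. overs (adj i p) (adj i q) D) = length D" .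
  have "(\<Sum>p\<in>{1..m}. \<Sum>q\<in>{1..m}. (if p = ?a \<and> q = ?b then 1 else 0 :: nat))
      = (\<Sum>p\<in>{1..m}. if p = ?a then (\<Sum>q\<in>{1..m}. if q = ?b then 1 else 0) else 0)"
    by (rule sum.cong) auto
  also have "\<dots> = 1" using i by (simp add: sum.delta)
  finally show ?case using 1 by (simp add: c sum.distrib)
qed auto

lemma overs_outside:
  assumes "D \<in> diagrams m" "p \<notin> {1..m} \<or> q \<notin> {1..m}"
  shows "overs p q D = 0"
  using assms
proof (induction p q D rule: overs.induct)
  case (2 p q i e D)
  then have i: "i \<in> {1..<m}" and D: "D \<in> diagrams m" by auto
  have "adj i p \<in> {1..m} \<longleftrightarrow> p \<in> {1..m}" "adj i q \<in> {1..m} \<longleftrightarrow> q \<in> {1..m}"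
    using i by (auto simp: transpose_def)
  then have "overs (adj i p) (adj i q) D = 0" using 2(1)[OF D] 2(3) by auto
  moreover have "\<not> (p = (if e then Suc i else i) \<and> q = (if e then i else Suc i))"
    using 2(3) i by auto
  ultimately show ?case by simp
qed auto

lemma crossings_outside: "D \<in> diagrams m \<Longrightarrow> p \<notin> {1..m} \<or> q \<notin> {1..m} \<Longrightarrow> crossings p q D = 0"
  by (auto simp: crossings_def overs_outside simp del: atLeastAtMost_iff)

text \<open>Turns goodness into a condition on the counts \<open>overs\<close>, which can be
  transferred between diagrams of one braid.\<close>

lemma over_all_iff: "over_all p D \<longleftrightarrow> (\<forall>q. overs q p D = 0)"
proof (induction D arbitrary: p)
  case (Cons c D)
  obtain i e where c: "c = (i, e)" by force
  have "(\<forall>q. overs q (adj i p) D = 0) \<longleftrightarrow> (\<forall>q. overs (adj i q) (adj i p) D = 0)"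
    by (metis transpose_involutory)
  moreover have "over_all p ((i, e) # D) \<longleftrightarrow>
      p \<noteq> (if e then i else Suc i) \<and> (\<forall>q. overs q (adj i p) D = 0)"
    using Cons.IH by simp
  moreover have "(\<forall>q. overs q p ((i, e) # D) = 0) \<longleftrightarrow>
      p \<noteq> (if e then i else Suc i) \<and> (\<forall>q. overs (adj i q) (adj i p) D = 0)"
    by (cases e) auto
  ultimately show ?case unfolding c by blast
qed simp

lemma simple_Cons: "simple ((i, e) # D) \<longleftrightarrow> simple D \<and> crossings i (Suc i) D = 0"
proof
  assume s: "simple ((i, e) # D)"
  have "crossings p q D \<le> 1" if "p \<noteq> q" for p q
  proof -
    have "adj i p \<noteq> adj i q" using that by simp
    then have "crossings (adj i p) (adj i q) ((i, e) # D) \<le> 1" using s unfolding simple_def by blast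
    then show ?thesis by (simp add: crossings_Cons)
  qed
  moreover have "crossings i (Suc i) ((i, e) # D) \<le> 1" using s unfolding simple_def by simp
  then have "crossings i (Suc i) D = 0" by (simp add: crossings_Cons crossings_commute)
  ultimately show "simple D \<and> crossings i (Suc i) D = 0" unfolding simple_def by blast
next
  assume s: "simple D \<and> crossings i (Suc i) D = 0"
  show "simple ((i, e) # D)" unfolding simple_def
  proof (intro allI impI)
    fix p q :: nat assume "p \<noteq> q"
    then have "crossings (adj i p) (adj i q) D \<le> 1" using s unfolding simple_def by simp
    moreover have "crossings (Suc i) i D = 0" using s by (simp add: crossings_commute)
    ultimately show "crossings p q ((i, e) # D) \<le> 1" using s by (auto simp: crossings_Cons)
  qed
qed

lemma simple_Nil [simp]: "simple []"
  by (simp add: simple_def)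

lemma simple_appendD: "simple (D @ E) \<Longrightarrow> simple D \<and> simple E"
proof
  assume s: "simple (D @ E)"
  show "simple D" using s unfolding simple_def crossings_append by (meson add_leE)
  show "simple E" unfolding simple_def
  proof (intro allI impI)
    fix p q :: nat assume "p \<noteq> q"
    then have "dest (dinv D) p \<noteq> dest (dinv D) q" by simp
    then have "crossings (dest (dinv D) p) (dest (dinv D) q) (D @ E) \<le> 1"
      using s unfolding simple_def by blast
    then show "crossings p q E \<le> 1" by (simp add: crossings_append)
  qed
qed

lemma simple_appendI:
  assumes "simple D" "simple E"
    and "\<And>p q. p \<noteq> q \<Longrightarrow> crossings p q D = 0 \<or> crossings (dest D p) (dest D q) E = 0"
  shows "simple (D @ E)"
  using assms unfolding simple_def crossings_append by (metis add.commute add_0 dest_inj)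

text \<open>\<open>dest (dinv D) i\<close> is the starting point of the strand that ends at position
  \<open>i\<close>; the added letter crosses the strands ending at \<open>i\<close> and
  \<open>Suc i\<close>.\<close>

lemma simple_snoc:
  "simple (D @ [(i, e)]) \<longleftrightarrow>
    simple D \<and> crossings (dest (dinv D) i) (dest (dinv D) (Suc i)) D = 0" (is "_ \<longleftrightarrow> _ \<and> ?c = 0")
proof
  assume s: "simple (D @ [(i, e)])"
  have "dest (dinv D) i \<noteq> dest (dinv D) (Suc i)" by simp
  then have "crossings (dest (dinv D) i) (dest (dinv D) (Suc i)) (D @ [(i, e)]) \<le> 1"
    using s unfolding simple_def by blast
  then show "simple D \<and> ?c = 0" using simple_appendD[OF s] by (simp add: crossings_append crossings_Cons)
next
  assume s: "simple D \<and> ?c = 0"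
  show "simple (D @ [(i, e)])"
  proof (rule simple_appendI)
    fix p q :: nat assume "p \<noteq> q"
    show "crossings p q D = 0 \<or> crossings (dest D p) (dest D q) [(i, e)] = 0"
    proof (rule disjCI)
      assume "crossings (dest D p) (dest D q) [(i, e)] \<noteq> 0"
      then have "dest D p = i \<and> dest D q = Suc i \<or> dest D p = Suc i \<and> dest D q = i"
        by (auto simp: crossings_Cons split: if_splits)
      then have "p = dest (dinv D) i \<and> q = dest (dinv D) (Suc i)
          \<or> p = dest (dinv D) (Suc i) \<and> q = dest (dinv D) i"
        by (metis dest_dinv1)
      then show "crossings p q D = 0" using s by (metis crossings_commute)
    qed
  qed (use s in \<open>auto simp: simple_Cons\<close>)
qed

section \<open>Calculation modulo the braid relations\<close>

lemma braid_rel_dinv_left: "u \<in> diagrams m \<Longrightarrow> (dinv u @ u, []) \<in> braid_rel m"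
  using braid_inverse[of u m] by (simp add: dinv_def)

lemma braid_rel_dinv_right: "u \<in> diagrams m \<Longrightarrow> (u @ dinv u, []) \<in> braid_rel m"
  using braid_rel_dinv_left[of "dinv u" m] by simp

lemma braid_rel_ctxt2:
  "(u, v) \<in> braid_rel m \<Longrightarrow> p \<in> diagrams m \<Longrightarrow> (p @ u, p @ v) \<in> braid_rel m"
  "(u, v) \<in> braid_rel m \<Longrightarrow> q \<in> diagrams m \<Longrightarrow> (u @ q, v @ q) \<in> braid_rel m"
  using braid_rel_ctxt[of u v m p "[]"] braid_rel_ctxt[of u v m "[]" q] by auto

declare braid_rel.trans [trans]

lemma braid_rel_cancel_left:
  assumes "(p @ u, p @ v) \<in> braid_rel m"
  shows "(u, v) \<in> braid_rel m"
proof -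
  have d: "p \<in> diagrams m" "u \<in> diagrams m" "v \<in> diagrams m"
    using braid_rel_diagrams[OF assms] by auto
  have "(u, dinv p @ p @ u) \<in> braid_rel m"
    using braid_rel.sym[OF braid_rel_ctxt2(2)[OF braid_rel_dinv_left[OF d(1)] d(2)]] by simp
  also have "(dinv p @ p @ u, dinv p @ p @ v) \<in> braid_rel m"
    using braid_rel_ctxt2(1)[OF assms] d by simp
  also have "(dinv p @ p @ v, v) \<in> braid_rel m"
    using braid_rel_ctxt2(2)[OF braid_rel_dinv_left[OF d(1)] d(3)] by simp
  finally show ?thesis .
qed

lemma braid_rel_dinv:
  assumes "(u, v) \<in> braid_rel m"
  shows "(dinv u, dinv v) \<in> braid_rel m"
proof (rule braid_rel_cancel_left)
  have d: "u \<in> diagrams m" "v \<in> diagrams m" using braid_rel_diagrams[OF assms] by auto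
  have "(u @ dinv u, []) \<in> braid_rel m" by (rule braid_rel_dinv_right[OF d(1)])
  also have "([], v @ dinv v) \<in> braid_rel m"
    by (rule braid_rel.sym[OF braid_rel_dinv_right[OF d(2)]])
  also have "(v @ dinv v, u @ dinv v) \<in> braid_rel m"
    using braid_rel_ctxt2(2)[OF braid_rel.sym[OF assms]] d by simp
  finally show "(u @ dinv u, u @ dinv v) \<in> braid_rel m" .
qed

lemma diagrams_mono: "u \<in> diagrams m \<Longrightarrow> u \<in> diagrams (Suc m)"
  unfolding diagrams_def by (auto elim!: lists_mono[THEN subsetD, rotated])

lemma braid_rel_mono: "(u, v) \<in> braid_rel m \<Longrightarrow> (u, v) \<in> braid_rel (Suc m)"
proof (induction rule: braid_rel.induct)
  case (cancel u v i e)
  then show ?case using braid_rel.cancel[of u "Suc m" v i e] by (simp add: diagrams_mono)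
next
  case (far u v i j)
  then show ?case using braid_rel.far[of u "Suc m" v i j] by (simp add: diagrams_mono)
next
  case (braid u v i)
  then show ?case using braid_rel.braid[of u "Suc m" v i] by (simp add: diagrams_mono)
qed (blast intro: braid_rel.refl braid_rel.sym braid_rel.trans diagrams_mono)+

section \<open>Removing a strand\<close>

lemma remove_strand_append:
  "remove_strand p (D @ E) = remove_strand p D @ remove_strand (dest D p) E"
  by (induction p D rule: remove_strand.induct) (auto simp: Let_def)

lemma remove_strand_diagrams:
  "D \<in> diagrams (Suc m) \<Longrightarrow> p \<in> {1..Suc m} \<Longrightarrow> remove_strand p D \<in> diagrams m"
proof (induction p D rule: remove_strand.induct)
  case (2 p i e D)
  then have i: "i \<in> {1..m}" and D: "D \<in> diagrams (Suc m)" by auto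
  have "adj i p \<in> {1..Suc m}" using i 2(3) by (auto simp: transpose_def)
  then have "remove_strand (adj i p) D \<in> diagrams m" using 2(1) D by simp
  then show ?case using i 2(3) by (auto simp: Let_def)
qed simp

text \<open>If the removed strand takes part in a relation, both sides become the same word;
  otherwise the relation persists, possibly with shifted indices.\<close>

lemma remove_strand_rel:
  "(u, v) \<in> braid_rel (Suc m) \<Longrightarrow> p \<in> {1..Suc m} \<Longrightarrow>
    (remove_strand p u, remove_strand p v) \<in> braid_rel m"
proof (induction rule: braid_rel.induct)
  case (refl u)
  then show ?case by (blast intro: braid_rel.refl remove_strand_diagrams)
next
  case (cancel u v i e)
  \<comment> \<open>The position at which the removed strand arrives at the two crossings of the
    relation.\<close>
  define q where "q = dest u p"
  have q: "q \<in> {1..Suc m}" using cancel dest_mem[of u "Suc m" p] by (simp add: q_def)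
  have d: "remove_strand p u \<in> diagrams m" "remove_strand q v \<in> diagrams m"
    using cancel q by (simp_all add: remove_strand_diagrams)
  have eq: "remove_strand p (u @ [(i, e), (i, \<not> e)] @ v) =
     remove_strand p u @ remove_strand q [(i, e), (i, \<not> e)] @ remove_strand q v"
    "remove_strand p (u @ v) = remove_strand p u @ remove_strand q v"
    by (simp_all only: remove_strand_append q_def dest_append dest.simps transpose_involutory)
  show ?case
  proof (cases "q = i \<or> q = Suc i")
    case True
    then have "remove_strand q [(i, e), (i, \<not> e)] = []" by auto
    then show ?thesis using d unfolding eq by (auto intro: braid_rel.refl)
  next
    case False
    then have "remove_strand q [(i, e), (i, \<not> e)] =
      [(if q < i then i - 1 else i, e), (if q < i then i - 1 else i, \<not> e)]" by (auto simp: Let_def)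
    moreover have "(if q < i then i - 1 else i) \<in> {1..<m}" using False q cancel by auto
    ultimately show ?thesis using d unfolding eq by (auto intro: braid_rel.cancel simp del: append_Cons)
  qed
next
  case (far u v i j)
  define q where "q = dest u p"
  have q: "q \<in> {1..Suc m}" using far dest_mem[of u "Suc m" p] by (simp add: q_def)
  have dd: "dest [(i, True), (j, True)] q = dest [(j, True), (i, True)] q"
    using far by (auto simp: transpose_def)
  define r where "r = dest [(j, True), (i, True)] q"
  have r: "r \<in> {1..Suc m}" using far q dest_mem[of "[(j, True), (i, True)]" "Suc m" q] by (simp add: r_def)
  have d: "remove_strand p u \<in> diagrams m" "remove_strand r v \<in> diagrams m"
    using far r by (simp_all add: remove_strand_diagrams)
  have eq: "remove_strand p (u @ [(i, True), (j, True)] @ v) =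
     remove_strand p u @ remove_strand q [(i, True), (j, True)] @ remove_strand r v"
    "remove_strand p (u @ [(j, True), (i, True)] @ v) =
     remove_strand p u @ remove_strand q [(j, True), (i, True)] @ remove_strand r v"
    by (simp_all only: remove_strand_append q_def[symmetric] dd r_def[symmetric])
  show ?case
  proof (cases "q = i \<or> q = Suc i \<or> q = j \<or> q = Suc j")
    case True
    then have a: "remove_strand q [(i, True), (j, True)] = remove_strand q [(j, True), (i, True)]"
      using far by (auto simp: Let_def transpose_def)
    have "remove_strand q [(j, True), (i, True)] \<in> diagrams m"
      using far q by (simp add: remove_strand_diagrams del: remove_strand.simps)
    then show ?thesis using d unfolding eq a by (auto intro!: braid_rel.refl simp del: remove_strand.simps)
  next
    case False
    let ?i = "if q < i then i - 1 else i" and ?j = "if q < j then j - 1 else j"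
    have a: "remove_strand q [(i, True), (j, True)] = [(?i, True), (?j, True)]"
      "remove_strand q [(j, True), (i, True)] = [(?j, True), (?i, True)]"
      using False by (auto simp: Let_def)
    have "?i \<in> {1..<m}" "?j \<in> {1..<m}" "?i + 2 \<le> ?j" using False q far by auto
    then show ?thesis using d unfolding eq a by (rule_tac braid_rel.far)
  qed
next
  case (braid u v i)
  define q where "q = dest u p"
  have q: "q \<in> {1..Suc m}" using braid dest_mem[of u "Suc m" p] by (simp add: q_def)
  let ?a = "[(i, True), (i + 1, True), (i, True)]" and ?b = "[(i + 1, True), (i, True), (i + 1, True)]"
  have dd: "dest ?a q = dest ?b q"
    by (auto simp: transpose_def)
  define r where "r = dest ?b q"
  have r: "r \<in> {1..Suc m}" using braid q dest_mem[of ?b "Suc m" q] by (simp add: r_def)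
  have d: "remove_strand p u \<in> diagrams m" "remove_strand r v \<in> diagrams m"
    using braid r by (simp_all add: remove_strand_diagrams)
  have eq: "remove_strand p (u @ ?a @ v) = remove_strand p u @ remove_strand q ?a @ remove_strand r v"
    "remove_strand p (u @ ?b @ v) = remove_strand p u @ remove_strand q ?b @ remove_strand r v"
    by (simp_all only: remove_strand_append q_def[symmetric] dd r_def[symmetric])
  show ?case
  proof (cases "q = i \<or> q = Suc i \<or> q = Suc (Suc i)")
    case True
    then have a: "remove_strand q ?a = remove_strand q ?b"
      by (auto simp: Let_def transpose_def)
    have "remove_strand q ?b \<in> diagrams m"
      using braid q by (simp add: remove_strand_diagrams del: remove_strand.simps)
    then show ?thesis using d unfolding eq a by (auto intro!: braid_rel.refl simp del: remove_strand.simps)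
  next
    case False
    let ?i = "if q < i then i - 1 else i"
    have a: "remove_strand q ?a = [(?i, True), (?i + 1, True), (?i, True)]"
      "remove_strand q ?b = [(?i + 1, True), (?i, True), (?i + 1, True)]"
      using False by (auto simp: Let_def)
    have "?i \<in> {1..<m}" "?i + 1 \<in> {1..<m}" using False q braid by auto
    then show ?thesis using d unfolding eq a by (rule_tac braid_rel.braid)
  qed
qed (blast intro: braid_rel.sym braid_rel.trans)+

text \<open>The increasing enumeration of the positions other than \<open>p\<close>: the strand
  called \<open>k\<close> after the removal of \<open>p\<close> was called \<open>skip p k\<close>
  before.\<close>

definition skip :: "nat \<Rightarrow> nat \<Rightarrow> nat" where
  "skip p k = (if k < p then k else Suc k)"

lemma skip_inj [simp]: "skip p k = skip p l \<longleftrightarrow> k = l"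
  by (auto simp: skip_def)

lemma adj_skip_cross: "p = i \<or> p = Suc i \<Longrightarrow> adj i (skip p k) = skip (adj i p) k"
  by (auto simp: skip_def transpose_def)

lemma adj_skip_other:
  "p \<noteq> i \<Longrightarrow> p \<noteq> Suc i \<Longrightarrow> adj i (skip p k) = skip p (adj (if p < i then i - 1 else i) k)"
  by (cases i) (auto simp: skip_def transpose_def)

lemma dest_skip: "dest D (skip p k) = skip (dest D p) (dest (remove_strand p D) k)"
proof (induction D arbitrary: p k)
  case (Cons c D)
  obtain i e where c: "c = (i, e)" by force
  show ?case
  proof (cases "p = i \<or> p = Suc i")
    case True
    then show ?thesis using Cons.IH adj_skip_cross[OF True, of k] by (auto simp: c)
  next
    case False
    then show ?thesis using Cons.IH adj_skip_other[of p i k] by (auto simp: c)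
  qed
qed simp

lemma overs_skip: "overs (skip p k) (skip p l) D = overs k l (remove_strand p D)"
proof (induction D arbitrary: p k l)
  case (Cons c D)
  obtain i e where c: "c = (i, e)" by force
  show ?case
  proof (cases "p = i \<or> p = Suc i")
    case True
    then have "skip p k = i \<longrightarrow> skip p l \<noteq> Suc i" "skip p k = Suc i \<longrightarrow> skip p l \<noteq> i"
      by (auto simp: skip_def)
    then show ?thesis using Cons.IH True adj_skip_cross[OF True] by (auto simp: c)
  next
    case False
    let ?i = "if p < i then i - 1 else i"
    have "skip p k = i \<longleftrightarrow> k = ?i" "skip p k = Suc i \<longleftrightarrow> k = Suc ?i" for k
      using False by (auto simp: skip_def)
    then have "overs (skip p k) (skip p l) ((i, e) # D) = overs k l ((?i, e) # remove_strand p D)"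
      using Cons.IH False adj_skip_other[of p i] by (simp del: skip_inj)
    then show ?thesis using False by (auto simp: c Let_def)
  qed
qed simp

lemma crossings_skip: "crossings (skip p k) (skip p l) D = crossings k l (remove_strand p D)"
  by (simp add: crossings_def overs_skip)

lemma simple_remove_strand: "simple D \<Longrightarrow> simple (remove_strand p D)"
  unfolding simple_def by (metis crossings_skip skip_inj)

lemma positive_remove_strand: "positive D \<Longrightarrow> positive (remove_strand p D)"
  by (induction p D rule: remove_strand.induct) (auto simp: Let_def)

text \<open>A strand of \<open>dinv D\<close> is, seen in \<open>D\<close>, one that starts where it
  ends in \<open>dinv D\<close>.\<close>

lemma remove_strand_dinv: "remove_strand p (dinv D) = dinv (remove_strand (dest (dinv D) p) D)"
proof (induction D arbitrary: p)
  case (Cons c D)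
  obtain i e where c: "c = (i, e)" by force
  define q where "q = dest (dinv D) p"
  have [simp]: "adj i q = i \<longleftrightarrow> q = Suc i" "adj i q = Suc i \<longleftrightarrow> q = i"
    by (auto simp: transpose_def)
  show ?case using Cons.IH[of p]
    by (auto simp: c dinv_Cons remove_strand_append q_def[symmetric] Let_def)
qed simp

section \<open>Strands over all others\<close>

lemma braid_rel_cancel_letter:
  "i \<in> {1..<m} \<Longrightarrow> u \<in> diagrams m \<Longrightarrow> ((i, e) # (i, \<not> e) # u, u) \<in> braid_rel m"
  using braid_rel.cancel[of "[]" m u i e] by simp

lemma braid_rel_Cons:
  "(u, v) \<in> braid_rel m \<Longrightarrow> i \<in> {1..<m} \<Longrightarrow> ((i, e) # u, (i, e) # v) \<in> braid_rel m"
  using braid_rel_ctxt2(1)[of u v m "[(i, e)]"] by simp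

text \<open>What commutes with a letter commutes with its inverse. This extends the commutation
  relation, given for positive letters, to all signs.\<close>

lemma braid_rel_far_inverse:
  assumes "([(i, True), (j, f)], [(j, f), (i, True)]) \<in> braid_rel m"
  shows "([(i, False), (j, f)], [(j, f), (i, False)]) \<in> braid_rel m"
proof (rule braid_rel_cancel_left[of "[(i, True)]"])
  have d: "i \<in> {1..<m}" "j \<in> {1..<m}" using braid_rel_diagrams[OF assms] by auto
  have "([(i, True), (i, False), (j, f)], [(j, f)]) \<in> braid_rel m"
    using braid_rel_cancel_letter[of i m "[(j, f)]" True] d by simp
  also have "([(j, f)], [(j, f), (i, True), (i, False)]) \<in> braid_rel m"
    using braid_rel.sym[OF braid_rel_Cons[OF braid_rel_cancel_letter[of i m "[]" True]]] d by simp
  also have "([(j, f), (i, True), (i, False)], [(i, True), (j, f), (i, False)]) \<in> braid_rel m"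
    using braid_rel_ctxt2(2)[OF braid_rel.sym[OF assms], of "[(i, False)]"] d by simp
  finally show "([(i, True)] @ [(i, False), (j, f)], [(i, True)] @ [(j, f), (i, False)]) \<in> braid_rel m"
    by simp
qed

lemma braid_rel_far:
  assumes "i \<in> {1..<m}" "j \<in> {1..<m}" "i + 2 \<le> j \<or> j + 2 \<le> i"
  shows "([(i, e), (j, f)], [(j, f), (i, e)]) \<in> braid_rel m"
proof -
  have "([(i, True), (j, True)], [(j, True), (i, True)]) \<in> braid_rel m"
    using assms braid_rel.far[of "[]" m "[]" i j] braid_rel.far[of "[]" m "[]" j i, THEN braid_rel.sym]
    by auto
  then have "([(i, e), (j, True)], [(j, True), (i, e)]) \<in> braid_rel m"
    using braid_rel_far_inverse by (cases e) auto
  then show ?thesis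
    using braid_rel_far_inverse[of j i e m, THEN braid_rel.sym] braid_rel.sym by (cases f) auto
qed

lemma braid_rel_far_list:
  assumes "i \<in> {1..<m}" "D \<in> diagrams m" "\<And>j. j \<in> fst ` set D \<Longrightarrow> i + 2 \<le> j \<or> j + 2 \<le> i"
  shows "((i, e) # D, D @ [(i, e)]) \<in> braid_rel m"
  using assms(2,3)
proof (induction D)
  case Nil
  then show ?case using assms(1) by (auto intro: braid_rel.refl)
next
  case (Cons c D)
  obtain j f where c: "c = (j, f)" by force
  have j: "j \<in> {1..<m}" "D \<in> diagrams m" "i + 2 \<le> j \<or> j + 2 \<le> i"
    using Cons.prems by (auto simp: c)
  have "((i, e) # (j, f) # D, (j, f) # (i, e) # D) \<in> braid_rel m"
    using braid_rel_ctxt2(2)[OF braid_rel_far[OF assms(1) j(1,3)] j(2)] by simp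
  also have "((j, f) # (i, e) # D, (j, f) # D @ [(i, e)]) \<in> braid_rel m"
    using Cons j by (intro braid_rel_Cons Cons.IH) auto
  finally show ?case by (simp add: c)
qed

text \<open>The third Reidemeister move with a strand on top: it passes over the two others from
  left to right, while their crossing, of either sign, slides beneath it.\<close>

lemma braid_rel_mixed:
  assumes "i \<in> {1..<m}" "Suc i \<in> {1..<m}"
  shows "([(Suc i, e), (i, False), (Suc i, False)], [(i, False), (Suc i, False), (i, e)]) \<in> braid_rel m"
proof -
  have F: "([(Suc i, False), (i, False), (Suc i, False)], [(i, False), (Suc i, False), (i, False)]) \<in> braid_rel m"
    using braid_rel.sym[OF braid_rel_dinv[OF braid_rel.braid[of "[]" m "[]" i]]] assms
    by (simp add: dinv_def)
  show ?thesis
  proof (cases e)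
    \<comment> \<open>Multiplication by \<open>(Suc i, False)\<close> on the left reduces this sign
      to \<open>F\<close>.\<close>
    case True
    have "([(Suc i, False), (Suc i, True), (i, False), (Suc i, False)], [(i, False), (Suc i, False)]) \<in> braid_rel m"
      using braid_rel_cancel_letter[of "Suc i" m "[(i, False), (Suc i, False)]" False] assms by simp
    also have "([(i, False), (Suc i, False)], [(i, False), (Suc i, False), (i, False), (i, True)]) \<in> braid_rel m"
      using braid_rel.sym[OF braid_rel.cancel[of "[(i, False), (Suc i, False)]" m "[]" i False]] assms
      by simp
    also have "([(i, False), (Suc i, False), (i, False), (i, True)],
        [(Suc i, False), (i, False), (Suc i, False), (i, True)]) \<in> braid_rel m"
      using braid_rel_ctxt2(2)[OF braid_rel.sym[OF F], of "[(i, True)]"] assms by simp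
    finally show ?thesis using True by (rule_tac braid_rel_cancel_left[of "[(Suc i, False)]"]) simp
  qed (use F in simp)
qed

section \<open>Pulling an upper strand to the last position\<close>

definition to_last :: "nat \<Rightarrow> nat \<Rightarrow> diagram" where
  "to_last p m = map (\<lambda>i. (i, False)) [p..<Suc m]"

definition from_last :: "nat \<Rightarrow> nat \<Rightarrow> diagram" where
  "from_last p m = map (\<lambda>i. (i, True)) (rev [p..<Suc m])"

lemma dinv_from_last: "dinv (from_last p m) = to_last p m"
  by (simp add: dinv_def from_last_def to_last_def rev_map o_def del: upt_Suc)

lemma to_last_diagrams: "1 \<le> p \<Longrightarrow> to_last p m \<in> diagrams (Suc m)"
  by (auto simp: to_last_def diagrams_def)

lemma from_last_diagrams: "1 \<le> p \<Longrightarrow> from_last p m \<in> diagrams (Suc m)"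
  by (auto simp: from_last_def diagrams_def)

lemma positive_from_last: "positive (from_last p m)"
  by (auto simp: from_last_def positive_def)

text \<open>According to the position of \<open>p\<close>, the letter is the first step of the path,
  or cancels with it, or lies to the left of \<open>p\<close> and commutes with the path, or lies to
  the right and slides under it with its index lowered by one.\<close>

lemma to_last_pass:
  assumes i: "i \<in> {1..m}" and p: "p \<in> {1..Suc m}" and over: "p \<noteq> (if e then i else Suc i)"
  shows "((i, e) # to_last (adj i p) m, to_last p m @ remove_strand p [(i, e)]) \<in> braid_rel (Suc m)"
proof -
  consider "p = i" | "p = Suc i" | "i + 2 \<le> p" | "p < i" by linarith
  then show ?thesis
  proof cases
    case 1
    then have "\<not> e" using over by (auto split: if_splits)
    then have "to_last p m = (i, e) # to_last (adj i p) m"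
      using i 1 by (simp add: to_last_def upt_conv_Cons del: upt_Suc)
    moreover have "to_last p m \<in> diagrams (Suc m)" using p by (simp add: to_last_diagrams)
    ultimately show ?thesis using 1 by (auto intro: braid_rel.refl)
  next
    case 2
    then have "e" using over by (auto split: if_splits)
    have "to_last (adj i p) m = (i, False) # to_last p m"
      using i 2 by (simp add: to_last_def upt_conv_Cons del: upt_Suc)
    moreover have "to_last p m \<in> diagrams (Suc m)" using p by (simp add: to_last_diagrams)
    ultimately show ?thesis using 2 i \<open>e\<close> braid_rel_cancel_letter[of i "Suc m" "to_last p m" True] by simp
  next
    case 3
    then have "adj i p = p" "remove_strand p [(i, e)] = [(i, e)]" by (auto simp: transpose_def)
    then show ?thesis using 3 i p
      by (auto simp: to_last_def image_image simp del: upt_Suc intro!: braid_rel_far_list to_last_diagrams[unfolded to_last_def])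
  next
    case 4
    \<comment> \<open>Only the letters \<open>k\<close> and \<open>Suc k\<close> of the path
      interact with the crossing; \<open>A\<close> is far from it before the slide and
      \<open>B\<close> after it.\<close>
    then obtain k where k: "i = Suc k" "p \<le> k" by (cases i) auto
    define A where "A = map (\<lambda>i. (i, False)) [p..<k]"
    define B where "B = map (\<lambda>i. (i, False)) [Suc (Suc k)..<Suc m]"
    have "[p..<Suc m] = [p..<k] @ [k..<Suc m]"
      using k i upt_add_eq_append[of p k "Suc m - k"] by simp
    also have "[k..<Suc m] = k # Suc k # [Suc (Suc k)..<Suc m]"
      using k i by (simp add: upt_conv_Cons del: upt_Suc)
    finally have to_last: "to_last p m = A @ [(k, False), (Suc k, False)] @ B"
      by (simp add: to_last_def A_def B_def)
    have [simp]: "adj i p = p" "remove_strand p [(i, e)] = [(k, e)]"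
      using k by (auto simp: transpose_def)
    have d: "A \<in> diagrams (Suc m)" "B \<in> diagrams (Suc m)" "k \<in> {1..<Suc m}" "Suc k \<in> {1..<Suc m}"
      using k p i by (auto simp: A_def B_def diagrams_def)
    have "((i, e) # A, A @ [(i, e)]) \<in> braid_rel (Suc m)"
      using k d by (intro braid_rel_far_list) (auto simp: A_def)
    from braid_rel_ctxt2(2)[OF this, of "[(k, False), (Suc k, False)] @ B"]
    have "((i, e) # to_last p m, A @ [(Suc k, e), (k, False), (Suc k, False)] @ B) \<in> braid_rel (Suc m)"
      using d by (simp add: to_last k)
    also have "(A @ [(Suc k, e), (k, False), (Suc k, False)] @ B,
        A @ [(k, False), (Suc k, False), (k, e)] @ B) \<in> braid_rel (Suc m)"
      using d by (intro braid_rel_ctxt braid_rel_mixed)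
    also have "((k, e) # B, B @ [(k, e)]) \<in> braid_rel (Suc m)"
      using d by (intro braid_rel_far_list) (auto simp: B_def)
    from braid_rel_ctxt2(1)[OF this, of "A @ [(k, False), (Suc k, False)]"]
    have "(A @ [(k, False), (Suc k, False), (k, e)] @ B, to_last p m @ [(k, e)]) \<in> braid_rel (Suc m)"
      using d by (simp add: to_last)
    finally show ?thesis by (simp del: remove_strand.simps)
  qed
qed

text \<open>Induction from the top: once the rest of the diagram has the desired form,
  \<open>to_last_pass\<close> moves the first crossing through the path.\<close>

lemma over_all_isotopy:
  "D \<in> diagrams (Suc m) \<Longrightarrow> p \<in> {1..Suc m} \<Longrightarrow> over_all p D \<Longrightarrow>
    (D, to_last p m @ remove_strand p D @ from_last (dest D p) m) \<in> braid_rel (Suc m)"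
proof (induction D arbitrary: p)
  case Nil
  then show ?case
    using braid_rel.sym[OF braid_rel_dinv_left[OF from_last_diagrams[of p m]]] by (simp add: dinv_from_last)
next
  case (Cons c D)
  obtain i e where c: "c = (i, e)" by force
  have i: "i \<in> {1..m}" and D: "D \<in> diagrams (Suc m)" using Cons.prems by (auto simp: c)
  let ?p = "adj i p"
  have p': "?p \<in> {1..Suc m}" using i Cons.prems by (auto simp: transpose_def)
  have R: "remove_strand ?p D @ from_last (dest D ?p) m \<in> diagrams (Suc m)"
    using remove_strand_diagrams[OF D p'] dest_mem[OF D, of ?p] p'
    by (auto simp: diagrams_mono from_last_diagrams)
  have "((i, e) # D, (i, e) # to_last ?p m @ remove_strand ?p D @ from_last (dest D ?p) m) \<in> braid_rel (Suc m)"
    using Cons.IH[OF D p'] Cons.prems(3) i by (intro braid_rel_Cons) (auto simp: c)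
  also have "((i, e) # to_last ?p m @ remove_strand ?p D @ from_last (dest D ?p) m,
     to_last p m @ remove_strand p [(i, e)] @ remove_strand ?p D @ from_last (dest D ?p) m) \<in> braid_rel (Suc m)"
  proof -
    have "p \<noteq> (if e then i else Suc i)" using Cons.prems by (cases e) (auto simp: c)
    from braid_rel_ctxt2(2)[OF to_last_pass[OF i Cons.prems(2) this] R] show ?thesis
      by (simp del: remove_strand.simps)
  qed
  also have "remove_strand p [(i, e)] @ remove_strand ?p D = remove_strand p ((i, e) # D)"
    using remove_strand_append[of p "[(i, e)]" D] by simp
  then have "to_last p m @ remove_strand p [(i, e)] @ remove_strand ?p D @ from_last (dest D ?p) m
     = to_last p m @ remove_strand p ((i, e) # D) @ from_last (dest D ?p) m"
    by (metis append.assoc)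
  finally show ?case by (simp add: c del: remove_strand.simps)
qed

section \<open>Inserting an upper strand into a simple diagram\<close>

definition inserted :: "nat \<Rightarrow> diagram \<Rightarrow> nat \<Rightarrow> nat \<Rightarrow> diagram \<Rightarrow> bool" where
  "inserted m D p q E \<longleftrightarrow> E \<in> diagrams (Suc m) \<and> simple E \<and> over_all p E \<and> dest E p = q \<and>
     remove_strand p E = D"

text \<open>The strand crossed first lies to the right of the new strand afterwards and also ends
  there, so in the simple diagram \<open>E\<close> the two do not meet again.\<close>

lemma inserted_left:
  assumes E: "inserted m D p q E" and p: "p \<in> {1..m}" and le: "q \<le> dest D p"
  shows "inserted m D (Suc p) q ((p, True) # E)"
proof -
  note E = E[unfolded inserted_def]
  have "dest E (Suc p) = skip q (dest D p)"
    using dest_skip[of E p p] E by (simp add: skip_def)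
  then have "dest E p < dest E (Suc p)" using E le by (simp add: skip_def)
  then have "crossings p (Suc p) E = 0" using E by (subst simple_crossings_iff) auto
  then show ?thesis using E p by (simp add: inserted_def simple_Cons)
qed

lemma inserted_right:
  assumes E: "inserted m D (Suc p) q E" and p: "p \<in> {1..m}" and less: "dest D p < q"
  shows "inserted m D p q ((p, False) # E)"
proof -
  note E = E[unfolded inserted_def]
  have "dest E p = skip q (dest D p)"
    using dest_skip[of E "Suc p" p] E by (simp add: skip_def)
  then have "dest E p < dest E (Suc p)" using E less by (simp add: skip_def)
  then have "crossings p (Suc p) E = 0" using E by (subst simple_crossings_iff) auto
  then show ?thesis using E p by (simp add: inserted_def simple_Cons)
qed

text \<open>Unless the new strand starts between the two strands of the first crossing, that
  crossing can stay on top; its index is shifted if the new strand starts to the left of it.\<close>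

lemma inserted_Cons:
  assumes E: "inserted m D p q E" and i: "i \<in> {1..<m}" and p: "p \<noteq> Suc i"
    and s: "simple ((i, e) # D)"
  shows "inserted m ((i, e) # D) p q ((if p \<le> i then Suc i else i, e) # E)"
proof -
  note E = E[unfolded inserted_def]
  have "crossings (skip p i) (skip p (Suc i)) E = 0"
    using E s by (simp add: crossings_skip simple_Cons)
  then have c: "crossings (if p \<le> i then Suc i else i) (Suc (if p \<le> i then Suc i else i)) E = 0"
    using p by (auto simp: skip_def split: if_splits)
  have "adj (if p \<le> i then Suc i else i) p = p"
    using p by (simp add: transpose_def)
  then show ?thesis using E c p i s
    by (cases "p \<le> i") (simp_all add: inserted_def simple_Cons Let_def)
qed

lemma insert_strand_Nil:
  assumes "p \<in> {1..Suc m}" "q \<in> {1..Suc m}"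
  shows "\<exists>E. inserted m [] p q E"
  using assms
\<comment> \<open>The distance from \<open>p\<close> to \<open>q\<close>, written so that natural
  subtraction does not truncate. The strand moves one step towards \<open>q\<close> at a
  time.\<close>
proof (induction "max p q - min p q" arbitrary: p)
  case 0
  then have "inserted m [] p q []" by (simp add: inserted_def max_def min_def split: if_splits)
  then show ?case by blast
next
  case (Suc d)
  consider "p < q" | "q < p" using Suc.hyps(2) by (metis diff_self_eq_0 linorder_neqE_nat max.idem min.idem nat.distinct(1))
  then show ?case
  proof cases
    case 1
    then have d: "d = max (Suc p) q - min (Suc p) q" using Suc.hyps(2) by simp
    have p: "Suc p \<in> {1..Suc m}" "p \<in> {1..m}" "dest [] p < q" using 1 Suc.prems by simp_all
    obtain E where "inserted m [] (Suc p) q E" using Suc.hyps(1)[OF d p(1) Suc.prems(2)] by blast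
    then show ?thesis using inserted_right[OF _ p(2,3)] by blast
  next
    case 2
    then obtain r where r: "p = Suc r" by (cases p) auto
    have d: "d = max r q - min r q" using Suc.hyps(2) 2 r by simp
    have p: "r \<in> {1..Suc m}" "r \<in> {1..m}" "q \<le> dest [] r" using 2 r Suc.prems by simp_all
    obtain E where "inserted m [] r q E" using Suc.hyps(1)[OF d p(1) Suc.prems(2)] by blast
    then show ?thesis using inserted_left[OF _ p(2,3)] r by blast
  qed
qed

text \<open>The problem is a start between the two strands of the first crossing. These exchange
  sides for good, so the new strand has to cross at least one of them anyway, and \<open>q\<close>
  tells which. It does so first and is then out of the way.\<close>

lemma insert_strand:
  assumes "D \<in> diagrams m" "simple D" "p \<in> {1..Suc m}" "q \<in> {1..Suc m}"
  shows "\<exists>E. inserted m D p q E"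
  using assms
proof (induction D arbitrary: p)
  case Nil
  then show ?case by (simp only: insert_strand_Nil)
next
  case (Cons c D)
  obtain i e where c: "c = (i, e)" by force
  have i: "i \<in> {1..<m}" and D: "D \<in> diagrams m" "simple D"
    using Cons.prems by (auto simp: c simple_Cons)
  have other: "\<exists>E. inserted m (c # D) r q E" if r: "r \<in> {1..Suc m}" "r \<noteq> Suc i" for r
    using Cons.IH[OF D r(1) Cons.prems(4)] inserted_Cons[OF _ i r(2)] Cons.prems(2) c by blast
  show ?case
  proof (cases "p = Suc i")
    case False
    then show ?thesis using other Cons.prems by blast
  next
    case p: True
    have "crossings i (Suc i) (c # D) \<noteq> 0" by (simp add: c crossings_Cons)
    then have rev: "dest (c # D) (Suc i) < dest (c # D) i"
    proof -
      have "\<not> dest (c # D) i < dest (c # D) (Suc i)"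
        using \<open>crossings i (Suc i) (c # D) \<noteq> 0\<close> simple_crossings_iff[OF Cons.prems(2), of i "Suc i"]
        by (simp split: if_splits)
      moreover have "dest (c # D) i \<noteq> dest (c # D) (Suc i)" by (subst dest_inj) simp
      ultimately show ?thesis by linarith
    qed
    show ?thesis
    proof (cases "q \<le> dest (c # D) i")
      case True
      have "i \<in> {1..Suc m}" "i \<noteq> Suc i" "i \<in> {1..m}" using i by simp_all
      then obtain E where "inserted m (c # D) i q E" using other by blast
      from inserted_left[OF this \<open>i \<in> {1..m}\<close> True] show ?thesis unfolding p by blast
    next
      case False
      then have less: "dest (c # D) (Suc i) < q" using rev by linarith
      have "Suc (Suc i) \<in> {1..Suc m}" "Suc (Suc i) \<noteq> Suc i" "Suc i \<in> {1..m}" using i by simp_all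
      then obtain E where "inserted m (c # D) (Suc (Suc i)) q E" using other by blast
      from inserted_right[OF this \<open>Suc i \<in> {1..m}\<close> less] show ?thesis unfolding p by blast
    qed
  qed
qed

section \<open>Mikado braids as fractions\<close>

text \<open>Words for the elements of the positive lift; see
  \<open>positive_lifts_eq\<close>.\<close>

definition permutation_word :: "nat \<Rightarrow> diagram \<Rightarrow> bool" where
  "permutation_word m D \<longleftrightarrow> D \<in> diagrams m \<and> positive D \<and> simple D"

lemma diagrams_less_2: "m < 2 \<Longrightarrow> D \<in> diagrams m \<Longrightarrow> D = []"
  by (cases D) (auto simp: diagrams_def)

text \<open>In a positive crossing the upper strand comes from the right. A strand that meets only
  strands starting to its left, each at most once, is therefore always above.\<close>

lemma over_all_if_rightmost:
  "positive D \<Longrightarrow> simple D \<Longrightarrow> (\<And>q. crossings p q D \<noteq> 0 \<Longrightarrow> q < p) \<Longrightarrow> over_all p D"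
proof (induction D arbitrary: p)
  case (Cons c D)
  obtain i where c: "c = (i, True)" using Cons.prems(1) by (cases c) auto
  have pi: "p \<noteq> i" using Cons.prems(3)[of "Suc i"] by (auto simp: c crossings_Cons)
  have "over_all (adj i p) D"
  proof (rule Cons.IH)
    fix q assume q: "crossings (adj i p) q D \<noteq> 0"
    define r where "r = adj i q"
    have qr: "q = adj i r" by (simp add: r_def)
    have r: "r < p" using q Cons.prems(3)[of r] by (simp add: c crossings_Cons qr)
    have "crossings i (Suc i) D = 0" using Cons.prems(2) by (simp add: c simple_Cons)
    then have "\<not> (p = Suc i \<and> r = i)" using q by (auto simp: qr)
    then show "q < adj i p" using r pi unfolding qr
      by (cases "r = i"; cases "r = Suc i"; cases "p = Suc i") (auto simp: transpose_def)
  qed (use Cons.prems in \<open>auto simp: c simple_Cons\<close>)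
  then show ?case using pi by (simp add: c)
qed simp

lemma permutation_word_over_all:
  "permutation_word (Suc m) D \<Longrightarrow> over_all (Suc m) D"
  unfolding permutation_word_def
proof (rule over_all_if_rightmost)
  fix q assume D: "D \<in> diagrams (Suc m) \<and> positive D \<and> simple D" and q: "crossings (Suc m) q D \<noteq> 0"
  then have "q \<in> {1..Suc m}" using crossings_outside[of D "Suc m" "Suc m" q] by metis
  moreover have "q \<noteq> Suc m" using q by (auto simp: crossings_def)
  ultimately show "q < Suc m" by simp
qed auto

lemma permutation_word_remove_strand:
  "permutation_word (Suc m) D \<Longrightarrow> p \<in> {1..Suc m} \<Longrightarrow> permutation_word m (remove_strand p D)"
  by (simp add: permutation_word_def simple_remove_strand positive_remove_strand
      remove_strand_diagrams)

lemma permutation_word_decomp: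
  assumes "permutation_word (Suc m) D"
  shows "(D, remove_strand (Suc m) D @ from_last (dest D (Suc m)) m) \<in> braid_rel (Suc m)"
  using over_all_isotopy[of D m "Suc m"] permutation_word_over_all[OF assms] assms
  by (simp add: permutation_word_def to_last_def)

text \<open>The strand that is last between \<open>dinv X\<close> and \<open>Y\<close> is above all
  others in both words. Without it a smaller fraction remains, which has a simple diagram by
  induction; the strand is then inserted on top, from \<open>p\<close> to \<open>q\<close>.\<close>

lemma stick_diagram:
  assumes "permutation_word m X" "permutation_word m Y"
  shows "\<exists>E. simple E \<and> (E, dinv X @ Y) \<in> braid_rel m \<and> (m > 0 \<longrightarrow> (\<exists>p\<in>{1..m}. over_all p E))"
  using assms
proof (induction m arbitrary: X Y)
  case 0
  then have "X = []" "Y = []" using diagrams_less_2[of 0] by (auto simp: permutation_word_def)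
  then show ?case by (auto intro!: exI[of _ "[]"] braid_rel.refl)
next
  case (Suc m)
  define p where "p = dest X (Suc m)"
  define q where "q = dest Y (Suc m)"
  define X' where "X' = remove_strand (Suc m) X"
  define Y' where "Y' = remove_strand (Suc m) Y"
  have XY': "permutation_word m X'" "permutation_word m Y'"
    using Suc.prems by (simp_all add: X'_def Y'_def permutation_word_remove_strand)
  have p: "p \<in> {1..Suc m}" and q: "q \<in> {1..Suc m}"
    using Suc.prems dest_mem[of _ "Suc m" "Suc m"] by (auto simp: p_def q_def permutation_word_def)
  obtain E' where E': "simple E'" "(E', dinv X' @ Y') \<in> braid_rel m" using Suc.IH[OF XY'] by blast
  have dE': "E' \<in> diagrams m" using braid_rel_diagrams[OF E'(2)] by simp
  obtain E where E: "inserted m E' p q E" using insert_strand[OF dE' E'(1) p q] by blast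
  note E = E[unfolded inserted_def]
  have d: "to_last p m \<in> diagrams (Suc m)" "from_last q m \<in> diagrams (Suc m)" "from_last p m \<in> diagrams (Suc m)"
    using p q by (auto simp: to_last_diagrams from_last_diagrams)
  have X: "(dinv X, to_last p m @ dinv X') \<in> braid_rel (Suc m)"
    using braid_rel_dinv[OF permutation_word_decomp[OF Suc.prems(1)]]
    by (simp add: dinv_append dinv_from_last p_def X'_def)
  have Y: "(Y, Y' @ from_last q m) \<in> braid_rel (Suc m)"
    using permutation_word_decomp[OF Suc.prems(2)] by (simp add: q_def Y'_def)
  have "(E, to_last p m @ E' @ from_last q m) \<in> braid_rel (Suc m)"
    using over_all_isotopy[of E m p] E p by simp
  also have "(to_last p m @ E' @ from_last q m, to_last p m @ (dinv X' @ Y') @ from_last q m) \<in> braid_rel (Suc m)"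
    by (intro braid_rel_ctxt braid_rel_mono E' d)
  also have "(to_last p m @ (dinv X' @ Y') @ from_last q m, dinv X @ Y) \<in> braid_rel (Suc m)"
    using braid_rel.sym[OF braid_rel_append[OF X Y]] by simp
  finally show ?case using E p by blast
qed

text \<open>Each count in \<open>D\<close> is at least the absolute value of the invariant, which is
  the count in \<open>E\<close>. The counts add up to the lengths, so if \<open>D\<close> is not
  longer, equality holds for every pair.\<close>

lemma overs_reduced:
  assumes E: "simple E" and ED: "(E, D) \<in> braid_rel m" and len: "length D \<le> length E"
  shows "overs p q D = overs p q E"
proof -
  have d: "E \<in> diagrams m" "D \<in> diagrams m" using braid_rel_diagrams[OF ED] by auto
  have le: "overs p q E \<le> overs p q D" for p q
    using simple_overs_signed_overs[OF E, of p q] abs_signed_overs_le[of p q D] signed_overs_rel[OF ED, of p q] by linarith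
  let ?I = "{1..m} \<times> {1..m}"
  have lenE: "length E = (\<Sum>(p, q)\<in>?I. overs p q E)" and lenD: "length D = (\<Sum>(p, q)\<in>?I. overs p q D)"
    using length_sum_overs d by (simp_all add: sum.cartesian_product)
  have le': "(\<Sum>(p, q)\<in>?I. overs p q E) \<le> (\<Sum>(p, q)\<in>?I. overs p q D)"
    using le by (intro sum_mono) auto
  have eq: "(\<Sum>(p, q)\<in>?I. overs p q E) = (\<Sum>(p, q)\<in>?I. overs p q D)"
    using le' len lenE lenD by linarith
  show ?thesis
  proof (cases "(p, q) \<in> ?I")
    case True
    have "(case (p, q) of (p, q) \<Rightarrow> overs p q E) = (case (p, q) of (p, q) \<Rightarrow> overs p q D)"
      by (rule sum_mono_inv[OF eq _ True]) (use le in auto)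
    then show ?thesis by simp
  next
    case False
    then show ?thesis using overs_outside[OF d(1), of p q] overs_outside[OF d(2), of p q] by auto
  qed
qed

lemma mikado_fraction:
  "permutation_word (Suc n) X \<Longrightarrow> permutation_word (Suc n) Y \<Longrightarrow>
    mikado (Suc n) (braid_of (Suc n) (dinv X @ Y))"
proof (induction n arbitrary: X Y)
  case 0
  then have "X = []" "Y = []" using diagrams_less_2[of 1] by (auto simp: permutation_word_def)
  then show ?case using mikado.trivial by (simp add: braid_group_def)
next
  case (Suc n)
  let ?m = "Suc (Suc n)"
  have d: "dinv X @ Y \<in> diagrams ?m" using Suc.prems by (simp add: permutation_word_def)
  let ?\<beta> = "braid_of ?m (dinv X @ Y)"
  have "mikado (Suc n + 1) ?\<beta>"
  proof (rule mikado.step)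
    show "?\<beta> \<in> carrier (braid_group (Suc n + 1))" using d by (simp add: braid_group_carrier)
  next
    fix D assume "reduced_diagram D ?\<beta>"
    then have D: "(dinv X @ Y, D) \<in> braid_rel ?m"
      and min: "\<And>E. (dinv X @ Y, E) \<in> braid_rel ?m \<Longrightarrow> length D \<le> length E"
      by (auto simp: reduced_diagram_def braid_of_def)
    obtain E p where E: "simple E" "(E, dinv X @ Y) \<in> braid_rel ?m" "p \<in> {1..?m}" "over_all p E"
      using stick_diagram[OF Suc.prems] by blast
    \<comment> \<open>Goodness depends on these counts alone, so the good strand of \<open>E\<close>
      is good in every reduced diagram.\<close>
    have "overs q p D = overs q p E" for q
      using overs_reduced[OF E(1) braid_rel.trans[OF E(2) D] min[OF braid_rel.sym[OF E(2)]]] .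
    then have "over_all p D" using E(4) by (simp add: over_all_iff)
    then have "\<exists>p. good_strand (Suc n + 1) D p" using E(3) by (auto simp: good_strand_def)
    moreover have "mikado (Suc n) (braid_of (Suc n) (remove_strand p D))"
      if p: "good_strand (Suc n + 1) D p" for p
    proof -
      have p: "p \<in> {1..Suc (Suc n)}" using p by (simp add: good_strand_def)
      \<comment> \<open>The position of the strand between \<open>dinv X\<close> and
        \<open>Y\<close>. As removal respects the braid relations, it may be carried out in
        \<open>dinv X @ Y\<close>, where it acts on two permutation words separately.\<close>
      define r where "r = dest (dinv X) p"
      have r: "r \<in> {1..Suc (Suc n)}"
        using dest_mem[of "dinv X" ?m p] p Suc.prems by (simp add: r_def permutation_word_def)
      have "remove_strand p (dinv X @ Y) = dinv (remove_strand r X) @ remove_strand r Y"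
        by (simp add: remove_strand_append remove_strand_dinv r_def)
      then have "braid_of (Suc n) (remove_strand p D)
          = braid_of (Suc n) (dinv (remove_strand r X) @ remove_strand r Y)"
        using braid_of_eqI[OF braid_rel.sym[OF remove_strand_rel[OF D p]]] by simp
      then show ?thesis
        using Suc.IH[OF permutation_word_remove_strand[OF Suc.prems(1) r]
            permutation_word_remove_strand[OF Suc.prems(2) r]] by simp
    qed
    ultimately show "(\<exists>p. good_strand (Suc n + 1) D p) \<and>
      (\<forall>p. good_strand (Suc n + 1) D p \<longrightarrow> mikado (Suc n) (braid_of (Suc n) (remove_strand p D)))"
      by blast
  qed
  then show ?case by simp
qed

section \<open>From Mikado braids to fractions\<close>

lemma dest_outside: "D \<in> diagrams m \<Longrightarrow> m < p \<Longrightarrow> dest D p = p"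
proof (induction D)
  case (Cons c D)
  then show ?case by (cases c) (auto simp: transpose_def)
qed simp

text \<open>The strand \<open>Suc m\<close> is untouched by \<open>X\<close> and then moves left
  only, so it meets every other strand at most once.\<close>

lemma permutation_word_from_last:
  assumes X: "permutation_word m X" and p: "1 \<le> p" "p \<le> Suc m"
  shows "permutation_word (Suc m) (X @ from_last p m)" "dest (X @ from_last p m) (Suc m) = p"
proof -
  have *: "simple (X @ from_last p m) \<and> dest (X @ from_last p m) (Suc m) = p"
    using p(2)
  \<comment> \<open>Downward induction; it starts at \<open>p = Suc m\<close>, where
    \<open>from_last\<close> is empty.\<close>
  proof (induction p rule: inc_induct)
    case base
    then show ?case using X dest_outside[of X m "Suc m"] by (simp add: from_last_def permutation_word_def)
  next
    case (step k)
    let ?D = "X @ from_last (Suc k) m"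
    have eq: "X @ from_last k m = ?D @ [(k, True)]"
      using step.hyps by (simp add: from_last_def upt_conv_Cons del: upt_Suc)
    \<comment> \<open>The strand that the new letter lets the last strand cross; so far it has
      stayed on the left.\<close>
    define r where "r = dest (dinv ?D) k"
    have top: "dest (dinv ?D) (Suc k) = Suc m" using step.IH by (metis dest_dinv1)
    have dr: "dest ?D r = k" by (simp only: r_def dest_dinv2)
    have "r < Suc m"
    proof (rule ccontr)
      assume "\<not> r < Suc m"
      moreover have "?D \<in> diagrams (Suc m)"
        using X by (simp add: permutation_word_def diagrams_mono from_last_diagrams)
      ultimately show False
        using dr step.IH step.hyps dest_outside[of ?D "Suc m" r] by (cases "r = Suc m") auto
    qed
    then have "crossings r (Suc m) ?D = 0" using step.IH dr by (subst simple_crossings_iff) auto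
    then have "simple (X @ from_last k m)" unfolding eq simple_snoc top r_def[symmetric] using step.IH by simp
    moreover have "dest (X @ from_last k m) (Suc m) = k" unfolding eq using step.IH by simp
    ultimately show ?case by simp
  qed
  then show "permutation_word (Suc m) (X @ from_last p m)" using X p
    by (simp add: permutation_word_def diagrams_mono from_last_diagrams positive_from_last)
  show "dest (X @ from_last p m) (Suc m) = p" using * by simp
qed

lemma mikado_imp_fraction:
  "mikado m \<beta> \<Longrightarrow>
    \<exists>X Y. permutation_word m X \<and> permutation_word m Y \<and> \<beta> = braid_of m (dinv X @ Y)"
proof (induction rule: mikado.induct)
  case trivial
  have "permutation_word 1 []" by (simp add: permutation_word_def)
  then show ?case by (intro exI[of _ "[]"]) (simp add: braid_group_def)
next
  case (step \<beta> m)
  obtain D0 where D0: "D0 \<in> diagrams (Suc m)" "\<beta> = braid_of (Suc m) D0"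
    using step.hyps by (auto simp: braid_group_carrier)
  then have "D0 \<in> \<beta>" by (auto simp: braid_of_def intro: braid_rel.refl)
  then obtain D where D: "D \<in> \<beta>" "\<And>E. E \<in> \<beta> \<Longrightarrow> length D \<le> length E"
    using ex_has_least_nat[of "\<lambda>D. D \<in> \<beta>" D0 length] by blast
  then have red: "reduced_diagram D \<beta>" by (simp add: reduced_diagram_def)
  have D0D: "(D0, D) \<in> braid_rel (Suc m)" using D(1) D0(2) by (simp add: braid_of_def)
  have dD: "D \<in> diagrams (Suc m)" using braid_rel_diagrams[OF D0D] by simp
  obtain p where p: "p \<in> {1..Suc m}" "over_all p D"
    and IH: "\<exists>X Y. permutation_word m X \<and> permutation_word m Y \<and>
      braid_of m (remove_strand p D) = braid_of m (dinv X @ Y)"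
    using step.IH[OF red] by (auto simp: good_strand_def)
  then obtain X Y where XY: "permutation_word m X" "permutation_word m Y"
    and eq: "braid_of m (remove_strand p D) = braid_of m (dinv X @ Y)" by blast
  define q where "q = dest D p"
  have q: "q \<in> {1..Suc m}" using dest_mem[OF dD, of p] p by (simp add: q_def)
  have "dinv X @ Y \<in> braid_of m (remove_strand p D)"
    using XY unfolding eq by (auto simp: braid_of_def permutation_word_def intro: braid_rel.refl)
  then have "(remove_strand p D, dinv X @ Y) \<in> braid_rel (Suc m)"
    by (auto simp: braid_of_def intro: braid_rel_mono)
  then have "(to_last p m @ remove_strand p D @ from_last q m, to_last p m @ (dinv X @ Y) @ from_last q m) \<in> braid_rel (Suc m)"
    using p q by (intro braid_rel_ctxt to_last_diagrams from_last_diagrams) auto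
  then have "(D, to_last p m @ (dinv X @ Y) @ from_last q m) \<in> braid_rel (Suc m)"
    using over_all_isotopy[OF dD p] unfolding q_def by (rule_tac braid_rel.trans)
  \<comment> \<open>Since \<open>to_last p m\<close> inverts \<open>from_last p m\<close>, the two
    outer paths are absorbed into denominator and numerator.\<close>
  then have "(D0, dinv (X @ from_last p m) @ (Y @ from_last q m)) \<in> braid_rel (Suc m)"
    using D0D by (simp add: dinv_append dinv_from_last braid_rel.trans)
  then have "\<beta> = braid_of (Suc m) (dinv (X @ from_last p m) @ (Y @ from_last q m))"
    using D0 braid_of_eqI by blast
  moreover have "permutation_word (Suc m) (X @ from_last p m)" "permutation_word (Suc m) (Y @ from_last q m)"
    using XY p q by (auto intro: permutation_word_from_last(1))
  ultimately show ?case by auto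
qed

section \<open>Exchange and half twists\<close>

lemma length_sum_crossings:
  assumes "D \<in> diagrams m"
  shows "2 * length D = (\<Sum>(p, q)\<in>{1..m} \<times> {1..m}. crossings p q D)"
proof -
  have "(\<Sum>(p, q)\<in>{1..m} \<times> {1..m}. crossings p q D) = (\<Sum>p\<in>{1..m}. \<Sum>q\<in>{1..m}. overs p q D)
      + (\<Sum>p\<in>{1..m}. \<Sum>q\<in>{1..m}. overs q p D)"
    by (simp add: crossings_def sum.distrib flip: sum.cartesian_product)
  also have "(\<Sum>p\<in>{1..m}. \<Sum>q\<in>{1..m}. overs q p D) = (\<Sum>p\<in>{1..m}. \<Sum>q\<in>{1..m}. overs p q D)"
    by (rule sum.swap)
  finally show ?thesis using length_sum_overs[OF assms] by simp
qed

lemma crossings_same [simp]: "crossings p p D = 0"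
  by (simp add: crossings_def)

lemma simple_crossings_le: "simple D \<Longrightarrow> crossings p q D \<le> 1"
  by (cases "p = q") (auto simp: simple_def)

lemma length_rel_positive:
  assumes "(u, v) \<in> braid_rel m" "positive u" "positive v"
  shows "length u = length v"
proof -
  have "2 * length u = 2 * length v"
    using braid_rel_diagrams[OF assms(1)] length_sum_crossings[of u m] length_sum_crossings[of v m]
    by (simp add: crossings_rel_positive[OF assms])
  then show ?thesis by simp
qed

lemma permutation_word_rel:
  assumes "(u, v) \<in> braid_rel m" "permutation_word m u" "positive v"
  shows "permutation_word m v"
  using assms braid_rel_diagrams[OF assms(1)] crossings_rel_positive[OF assms(1)]
  unfolding permutation_word_def simple_def by simp

lemma simple_crossing_iff:
  "simple D \<Longrightarrow> p < q \<Longrightarrow> crossings p q D \<noteq> 0 \<longleftrightarrow> dest D q < dest D p"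
  using simple_crossings_iff[of D p q] dest_inj[of D p q] by (auto simp del: dest_inj)

lemma permutation_word_Cons:
  "permutation_word m ((i, e) # D) \<longleftrightarrow>
    i \<in> {1..<m} \<and> e \<and> permutation_word m D \<and> crossings i (Suc i) D = 0"
  by (auto simp: permutation_word_def simple_Cons)

text \<open>The exchange property, realized by braid relations. If the first letter is
  \<open>k\<close> or far from \<open>k\<close>, this is direct. If it is a neighbour of
  \<open>k\<close>, the three strands concerned cross pairwise, and two uses of the induction
  hypothesis produce one side of a braid relation whose other side starts with
  \<open>k\<close>.\<close>

lemma exchange:
  "permutation_word m D \<Longrightarrow> crossings k (Suc k) D \<noteq> 0 \<Longrightarrow>
    \<exists>E. permutation_word m E \<and> ((k, True) # E, D) \<in> braid_rel m"
proof (induction D arbitrary: k rule: length_induct)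
  case (1 D)
  note pw = 1(2) and c = 1(3)
  have d: "D \<in> diagrams m" using pw by (simp add: permutation_word_def)
  have k: "k \<in> {1..<m}"
    using crossings_outside[OF d, of k "Suc k"] c by fastforce
  have IH: "\<exists>F. permutation_word m F \<and> positive F \<and> ((l, True) # F, E) \<in> braid_rel m
      \<and> permutation_word m ((l, True) # F) \<and> length F < length E"
    if E: "permutation_word m E" "crossings l (Suc l) E \<noteq> 0" "length E < length D" for E l
  proof -
    obtain F where F: "permutation_word m F" "((l, True) # F, E) \<in> braid_rel m"
      using 1(1)[rule_format, OF E(3,1,2)] by blast
    have pos: "positive F" "positive E" using F E by (simp_all add: permutation_word_def)
    moreover have "length E = Suc (length F)" using length_rel_positive[OF F(2)] pos by simp
    ultimately show ?thesis
      using F permutation_word_rel[OF braid_rel.sym[OF F(2)] E(1)] by auto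
  qed
  have fin: ?case if "((k, True) # E, D) \<in> braid_rel m" "positive E" for E
    using permutation_word_rel[OF braid_rel.sym[OF that(1)] pw] that permutation_word_Cons by auto
  obtain j D1 where D: "D = (j, True) # D1"
    using c pw by (cases D) (auto simp: permutation_word_def)
  have j: "j \<in> {1..<m}" and pw1: "permutation_word m D1" and j0: "crossings j (Suc j) D1 = 0"
    using pw by (simp_all add: D permutation_word_Cons)
  have s1: "simple D1" and d1: "D1 \<in> diagrams m" and pos1: "positive D1"
    using pw1 by (simp_all add: permutation_word_def)
  consider "j = k" | "j + 2 \<le> k \<or> k + 2 \<le> j" | "j = Suc k" | "k = Suc j" by linarith
  then show ?case
  proof cases
    case 1
    then show ?thesis using pw1 braid_rel.refl[OF d] by (auto simp: D)
  next
    case 2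
    then have "crossings k (Suc k) D1 \<noteq> 0" using c by (auto simp: D crossings_Cons transpose_def)
    then obtain E where E: "positive E" "((k, True) # E, D1) \<in> braid_rel m" using IH[OF pw1] D by auto
    have dE: "E \<in> diagrams m" using braid_rel_diagrams[OF E(2)] by simp
    have "((k, True) # (j, True) # E, (j, True) # (k, True) # E) \<in> braid_rel m"
      using braid_rel_ctxt2(2)[OF braid_rel_far[OF k j, of True True] dE] 2 by auto
    also have "((j, True) # (k, True) # E, D) \<in> braid_rel m"
      unfolding D by (rule braid_rel_Cons[OF E(2) j])
    finally show ?thesis by (rule fin) (simp add: E)
  next
    case 3
    have c1: "crossings k (Suc (Suc k)) D1 \<noteq> 0" using c by (simp add: D 3 crossings_Cons transpose_def)
    \<comment> \<open>In \<open>D1\<close> the strands \<open>Suc k\<close> and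
      \<open>Suc (Suc k)\<close> keep their order while \<open>k\<close> and
      \<open>Suc (Suc k)\<close> are inverted; hence \<open>k\<close> and \<open>Suc k\<close> are
      inverted too.\<close>
    have "crossings k (Suc k) D1 \<noteq> 0"
      using c1 j0 3 simple_crossing_iff[OF s1, of k "Suc (Suc k)"] simple_crossing_iff[OF s1, of k "Suc k"]
        simple_crossing_iff[OF s1, of "Suc k" "Suc (Suc k)"] by auto
    then obtain D2 where D2: "permutation_word m D2" "positive D2" "((k, True) # D2, D1) \<in> braid_rel m"
      "length D2 < length D1" using IH[OF pw1] D by auto
    have "crossings k (Suc (Suc k)) ((k, True) # D2) \<noteq> 0"
      using c1 crossings_rel_positive[OF D2(3)] D2(2) pos1 by simp
    then have "crossings (Suc k) (Suc (Suc k)) D2 \<noteq> 0" by (simp add: crossings_Cons transpose_def)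
    then obtain E where E: "positive E" "((Suc k, True) # E, D2) \<in> braid_rel m"
      using IH[OF D2(1)] D2(4) D by auto
    have dE: "E \<in> diagrams m" using braid_rel_diagrams[OF E(2)] by simp
    have "((k, True) # (Suc k, True) # (k, True) # E, (Suc k, True) # (k, True) # (Suc k, True) # E) \<in> braid_rel m"
      using braid_rel.braid[of "[]" m E k] dE k j 3 by simp
    also have "((Suc k, True) # (k, True) # (Suc k, True) # E, (Suc k, True) # (k, True) # D2) \<in> braid_rel m"
      using E k j 3 by (intro braid_rel_Cons) auto
    also have "((Suc k, True) # (k, True) # D2, D) \<in> braid_rel m"
      using braid_rel_Cons[OF D2(3) j] by (simp add: D 3)
    finally show ?thesis by (rule fin) (simp add: E)
  next
    case 4
    have c1: "crossings j (Suc (Suc j)) D1 \<noteq> 0" using c by (simp add: D 4 crossings_Cons transpose_def)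
    have "crossings (Suc j) (Suc (Suc j)) D1 \<noteq> 0"
      using c1 j0 4 simple_crossing_iff[OF s1, of j "Suc (Suc j)"] simple_crossing_iff[OF s1, of j "Suc j"]
        simple_crossing_iff[OF s1, of "Suc j" "Suc (Suc j)"] by auto
    then obtain D2 where D2: "permutation_word m D2" "positive D2" "((Suc j, True) # D2, D1) \<in> braid_rel m"
      "length D2 < length D1" using IH[OF pw1] D by auto
    have "crossings j (Suc (Suc j)) ((Suc j, True) # D2) \<noteq> 0"
      using c1 crossings_rel_positive[OF D2(3)] D2(2) pos1 by simp
    then have "crossings j (Suc j) D2 \<noteq> 0" by (simp add: crossings_Cons transpose_def)
    then obtain E where E: "positive E" "((j, True) # E, D2) \<in> braid_rel m"
      using IH[OF D2(1)] D2(4) D by auto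
    have dE: "E \<in> diagrams m" using braid_rel_diagrams[OF E(2)] by simp
    have "((Suc j, True) # (j, True) # (Suc j, True) # E, (j, True) # (Suc j, True) # (j, True) # E) \<in> braid_rel m"
      using braid_rel.sym[OF braid_rel.braid[of "[]" m E j]] dE k j 4 by simp
    also have "((j, True) # (Suc j, True) # (j, True) # E, (j, True) # (Suc j, True) # D2) \<in> braid_rel m"
      using E k j 4 by (intro braid_rel_Cons) auto
    also have "((j, True) # (Suc j, True) # D2, D) \<in> braid_rel m"
      using braid_rel_Cons[OF D2(3) j] by (simp add: D)
    finally show ?thesis unfolding 4[symmetric] by (rule fin) (simp add: E)
  qed
qed

text \<open>Matsumoto's theorem in geometric form: \<open>exchange\<close> brings the first letter
  of \<open>D\<close> to the front of \<open>E\<close>, and it is removed from both words.\<close>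

lemma permutation_word_unique:
  "permutation_word m D \<Longrightarrow> permutation_word m E \<Longrightarrow> (\<And>p q. crossings p q D = crossings p q E) \<Longrightarrow>
    (D, E) \<in> braid_rel m"
proof (induction D arbitrary: E)
  case Nil
  have "E = []"
  proof (cases E)
    case (Cons c E')
    then show ?thesis using Nil(3)[of "fst c" "Suc (fst c)"] by (cases c) (simp add: crossings_Cons)
  qed
  then show ?case by (auto intro: braid_rel.refl)
next
  case (Cons c D)
  obtain k where c: "c = (k, True)" using Cons.prems(1) by (cases c) (auto simp: permutation_word_def)
  have k: "k \<in> {1..<m}" and D: "permutation_word m D"
    using Cons.prems(1) by (auto simp: c permutation_word_Cons)
  have "crossings k (Suc k) E \<noteq> 0" using Cons.prems(3)[of k "Suc k"] by (simp add: c crossings_Cons)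
  then obtain F where F: "permutation_word m F" "((k, True) # F, E) \<in> braid_rel m"
    using exchange[OF Cons.prems(2)] by blast
  have "crossings p q ((k, True) # F) = crossings p q ((k, True) # D)" for p q
    using crossings_rel_positive[OF F(2)] F(1) Cons.prems by (simp add: c permutation_word_def)
  then have "crossings (adj k p) (adj k q) F = crossings (adj k p) (adj k q) D" for p q
    by (simp add: crossings_Cons)
  then have "crossings p q F = crossings p q D" for p q by (metis transpose_involutory)
  then have "(D, F) \<in> braid_rel m" using Cons.IH[OF D F(1)] by simp
  then have "((k, True) # D, (k, True) # F) \<in> braid_rel m" using k by (rule braid_rel_Cons)
  then show ?case using F(2) unfolding c by (rule braid_rel.trans)
qed

section \<open>Half twists and complements\<close>

definition half_twist :: "nat \<Rightarrow> diagram \<Rightarrow> bool" where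
  "half_twist m D \<longleftrightarrow> (\<forall>p\<in>{1..m}. \<forall>q\<in>{1..m}. p \<noteq> q \<longrightarrow> crossings p q D \<noteq> 0)"

lemma half_twist_crossings:
  assumes "permutation_word m D" "half_twist m D"
  shows "crossings p q D = (if p \<in> {1..m} \<and> q \<in> {1..m} \<and> p \<noteq> q then 1 else 0)"
proof (cases "p \<in> {1..m} \<and> q \<in> {1..m} \<and> p \<noteq> q")
  case True
  then have "crossings p q D \<noteq> 0" "crossings p q D \<le> 1"
    using assms by (auto simp: half_twist_def permutation_word_def simple_def)
  then show ?thesis using True by simp
next
  case False
  then show ?thesis using assms(1) crossings_outside[of D m p q] by (auto simp: permutation_word_def)
qed

lemma half_twist_unique:
  "permutation_word m D \<Longrightarrow> half_twist m D \<Longrightarrow> permutation_word m E \<Longrightarrow> half_twist m E \<Longrightarrow> (D, E) \<in> braid_rel m"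
  by (rule permutation_word_unique) (simp_all only: half_twist_crossings)

text \<open>If all neighbouring strands cross, the endpoints form a decreasing sequence, so every
  pair is inverted.\<close>

lemma half_twistI:
  assumes D: "permutation_word m D" and adjacent: "\<And>k. k \<in> {1..<m} \<Longrightarrow> crossings k (Suc k) D \<noteq> 0"
  shows "half_twist m D"
proof -
  have s: "simple D" using D by (simp add: permutation_word_def)
  have less: "dest D q < dest D p" if "1 \<le> p" "p < q" "q \<le> m" for p q
    using that(2,3)
  proof (induction q)
    case (Suc q)
    have "dest D (Suc q) < dest D q" if "1 \<le> q"
      using adjacent[of q] simple_crossing_iff[OF s, of q "Suc q"] that Suc.prems by simp
    then show ?case using Suc that(1) by (cases "p = q") (auto intro: less_trans)
  qed simp
  show ?thesis unfolding half_twist_def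
  proof (intro ballI impI)
    fix p q assume "p \<in> {1..m}" "q \<in> {1..m}" "p \<noteq> q"
    then show "crossings p q D \<noteq> 0"
      using less[of p q] less[of q p] simple_crossing_iff[OF s, of p q] simple_crossing_iff[OF s, of q p]
      by (cases p q rule: linorder_cases) (auto simp: crossings_commute)
  qed
qed

lemma permutation_word_length: "permutation_word m D \<Longrightarrow> length D \<le> m * m"
proof -
  assume D: "permutation_word m D"
  then have "2 * length D = (\<Sum>(p, q)\<in>{1..m} \<times> {1..m}. crossings p q D)"
    by (intro length_sum_crossings) (simp add: permutation_word_def)
  also have "\<dots> \<le> (\<Sum>(p, q)\<in>{1..m} \<times> {1..m}. 1)"
    using D by (intro sum_mono) (auto simp: permutation_word_def intro: simple_crossings_le[simplified])
  also have "\<dots> = m * m" by simp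
  finally show ?thesis by simp
qed

text \<open>As long as two neighbouring strands do not cross, a letter in front makes them cross.
  The crude bound \<open>m * m\<close> on the length ends this process, at a half twist by
  \<open>half_twistI\<close>.\<close>

lemma left_complement:
  "permutation_word m X \<Longrightarrow> \<exists>Z. permutation_word m (Z @ X) \<and> half_twist m (Z @ X)"
proof (induction "m * m - length X" arbitrary: X rule: less_induct)
  case less
  show ?case
  proof (cases "\<exists>k\<in>{1..<m}. crossings k (Suc k) X = 0")
    case True
    then obtain k where "k \<in> {1..<m}" "crossings k (Suc k) X = 0" by blast
    then have pw: "permutation_word m ((k, True) # X)"
      using less.prems by (simp add: permutation_word_Cons)
    then have "m * m - length ((k, True) # X) < m * m - length X"
      using permutation_word_length[OF pw] by simp
    from less.hyps[OF this pw] obtain Z where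
      "permutation_word m (Z @ (k, True) # X)" "half_twist m (Z @ (k, True) # X)" by blast
    then show ?thesis by (intro exI[of _ "Z @ [(k, True)]"]) simp
  next
    case False
    then have "half_twist m X" using half_twistI[OF less.prems] by auto
    then show ?thesis using less.prems by (intro exI[of _ "[]"]) simp
  qed
qed

lemma dest_rev: "dest (rev D) p = dest (dinv D) p"
proof (induction D arbitrary: p)
  case (Cons c D)
  then show ?case by (cases c) (simp add: dinv_Cons)
qed simp

text \<open>Reversal without inverting the letters exchanges starts and ends but, unlike
  \<open>dinv\<close>, preserves positivity. It turns left complements into right ones.\<close>

lemma crossings_rev: "crossings (dest D p) (dest D q) (rev D) = crossings p q D"
proof (induction D arbitrary: p q)
  case (Cons c D)
  obtain i e where c: "c = (i, e)" by force
  have [simp]: "adj i p = i \<longleftrightarrow> p = Suc i" "adj i p = Suc i \<longleftrightarrow> p = i" for p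
    by (auto simp: transpose_def)
  show ?case using Cons.IH[of "adj i p" "adj i q"]
    by (auto simp: c crossings_append crossings_Cons dest_rev)
qed simp

lemma crossings_rev': "crossings p q (rev D) = crossings (dest (dinv D) p) (dest (dinv D) q) D"
  using crossings_rev[of D "dest (dinv D) p" "dest (dinv D) q"] by simp

lemma permutation_word_rev: "permutation_word m D \<Longrightarrow> permutation_word m (rev D)"
  unfolding permutation_word_def simple_def by (auto simp: crossings_rev' diagrams_def)

lemma half_twist_rev: "D \<in> diagrams m \<Longrightarrow> half_twist m D \<Longrightarrow> half_twist m (rev D)"
  unfolding half_twist_def crossings_rev' using dest_mem[of "dinv D" m] by simp

lemma right_complement:
  assumes "permutation_word m X"
  shows "\<exists>Z. permutation_word m (X @ Z) \<and> half_twist m (X @ Z)"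
proof -
  obtain Z where Z: "permutation_word m (Z @ rev X)" "half_twist m (Z @ rev X)"
    using left_complement[OF permutation_word_rev[OF assms]] by blast
  have "permutation_word m (X @ rev Z)" using permutation_word_rev[OF Z(1)] by simp
  moreover have "half_twist m (X @ rev Z)"
    using half_twist_rev[OF _ Z(2)] Z(1) by (simp add: permutation_word_def)
  ultimately show ?thesis by blast
qed

lemma permutation_word_append:
  "permutation_word m (X @ Y) \<Longrightarrow> permutation_word m X \<and> permutation_word m Y"
  using simple_appendD[of X Y] by (auto simp: permutation_word_def)

section \<open>Positive lifts\<close>

definition positive_word :: "nat list \<Rightarrow> diagram" where
  "positive_word is = map (\<lambda>i. (i, True)) is"

lemma positive_word_simps [simp]: "positive_word [] = []" "positive_word (i # is) = (i, True) # positive_word is" "length (positive_word is) = length is"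
  by (simp_all add: positive_word_def)

lemma positive_positive_word [simp]: "positive (positive_word is)"
  by (auto simp: positive_word_def positive_def)

lemma positive_word_diagrams [simp]: "positive_word is \<in> diagrams m \<longleftrightarrow> set is \<subseteq> {1..<m}"
  by (auto simp: positive_word_def diagrams_def)

lemma positive_word_fst: "positive D \<Longrightarrow> positive_word (map fst D) = D"
  by (induction D) (auto simp: positive_word_def positive_def)

lemma word_prod_braid:
  "set is \<subseteq> {1..<m} \<Longrightarrow> word_prod (braid_group m) (sigma m) is = braid_of m (positive_word is)"
proof (induction "is")
  case (Cons i "is")
  then show ?case using braid_group_mult[of "[(i, True)]" m "positive_word is"]
    by (simp add: word_prod_def sigma_def)
qed (simp add: word_prod_def braid_group_def)

text \<open>Permutations compose from right to left whereas strands are followed from top to bottom,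
  so the product in the symmetric group is the inverse of the strand permutation.\<close>

lemma word_prod_sym:
  "word_prod (sym_group m) (\<lambda>i. transpose i (i + 1)) is = dest (dinv (positive_word is))"
proof (induction "is")
  case Nil
  show ?case by (simp add: word_prod_def sym_group_def fun_eq_iff)
next
  case (Cons i "is")
  then show ?case by (simp add: word_prod_def sym_group_def fun_eq_iff dinv_Cons)
qed

lemma expression_iff:
  "expression m is w \<longleftrightarrow> positive_word is \<in> diagrams m \<and> w = dest (dinv (positive_word is))"
  unfolding expression_def word_prod_sym by auto

lemma dest_dinv_eq_iff: "dest (dinv D) = dest (dinv E) \<longleftrightarrow> dest D = dest E"
proof -
  have "dest D = dest E" if "dest (dinv D) = dest (dinv E)" for D E
  proof
    fix p
    have "dest D p = dest E (dest (dinv E) (dest D p))" by simp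
    also have "\<dots> = dest E p" unfolding that[symmetric] by simp
    finally show "dest D p = dest E p" .
  qed
  from this[of D E] this[of "dinv D" "dinv E"] show ?thesis by auto
qed

text \<open>Letters are added in front. One that would make two strands cross again is cancelled
  against the letter supplied by \<open>exchange\<close>, which leaves the permutation
  unchanged.\<close>

lemma exists_permutation_word:
  "D \<in> diagrams m \<Longrightarrow> positive D \<Longrightarrow> \<exists>E. permutation_word m E \<and> dest E = dest D"
proof (induction D)
  case Nil
  have "permutation_word m []" by (simp add: permutation_word_def)
  then show ?case by blast
next
  case (Cons c D)
  obtain k where c: "c = (k, True)" using Cons.prems by (cases c) auto
  have k: "k \<in> {1..<m}" and D: "D \<in> diagrams m" "positive D" using Cons.prems by (auto simp: c)
  obtain E where E: "permutation_word m E" "dest E = dest D" using Cons.IH[OF D] by blast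
  show ?case
  proof (cases "crossings k (Suc k) E = 0")
    case True
    have "dest ((k, True) # E) = dest (c # D)" using E by (simp add: c fun_eq_iff)
    then show ?thesis using True E k by (intro exI[of _ "(k, True) # E"]) (simp add: permutation_word_Cons)
  next
    case False
    then obtain F where F: "permutation_word m F" "((k, True) # F, E) \<in> braid_rel m"
      using exchange[OF E(1)] by blast
    have "dest F p = dest (c # D) p" for p
      using dest_rel[OF F(2), of "adj k p"] E by (simp add: c)
    then show ?thesis using F(1) by blast
  qed
qed

text \<open>By parity, a pair inverted by the permutation crosses in every diagram of it.\<close>

lemma crossings_ge_simple:
  assumes "simple E" "dest D = dest E"
  shows "crossings p q E \<le> crossings p q D"
proof (cases "p = q")
  case False
  have "odd (crossings p q D) \<longleftrightarrow> odd (crossings p q E)"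
    unfolding crossings_parity[OF False] assms(2) ..
  moreover have "crossings p q E = 0 \<or> crossings p q E = 1" using simple_crossings_le[OF assms(1), of p q] by linarith
  ultimately show ?thesis by (cases "crossings p q D = 0") auto
qed simp

lemma length_permutation_word_le:
  assumes E: "permutation_word m E" and D: "D \<in> diagrams m" "dest D = dest E"
  shows "length E \<le> length D" and "length D \<le> length E \<Longrightarrow> simple D"
proof -
  have s: "simple E" and dE: "E \<in> diagrams m" using E by (simp_all add: permutation_word_def)
  let ?I = "{1..m} \<times> {1..m}"
  have le: "(\<Sum>(p, q)\<in>?I. crossings p q E) \<le> (\<Sum>(p, q)\<in>?I. crossings p q D)"
    using crossings_ge_simple[OF s D(2)] by (intro sum_mono) auto
  then have le2: "2 * length E \<le> 2 * length D" using length_sum_crossings[OF dE] length_sum_crossings[OF D(1)] by simp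
  then show "length E \<le> length D" by simp
  assume "length D \<le> length E"
  then have eq: "(\<Sum>(p, q)\<in>?I. crossings p q E) = (\<Sum>(p, q)\<in>?I. crossings p q D)"
    using length_sum_crossings[OF dE] length_sum_crossings[OF D(1)] le by linarith
  have "crossings p q D \<le> 1" for p q
  proof (cases "(p, q) \<in> ?I")
    case True
    have "(case (p, q) of (p, q) \<Rightarrow> crossings p q E) = (case (p, q) of (p, q) \<Rightarrow> crossings p q D)"
      by (rule sum_mono_inv[OF eq _ True]) (use crossings_ge_simple[OF s D(2)] in auto)
    then show ?thesis using simple_crossings_le[OF s, of p q] by simp
  next
    case False
    then show ?thesis using crossings_outside[OF D(1), of p q] by auto
  qed
  then show "simple D" by (simp add: simple_def)
qed

text \<open>A simple word attains the minimal number of crossings for each pair separately. A word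
  of the same total length must do so as well and is therefore simple.\<close>

lemma reduced_expression_iff:
  "reduced_expression m is w \<longleftrightarrow> permutation_word m (positive_word is) \<and> w = dest (dinv (positive_word is))"
proof -
  have "length is = perm_length m w"
    if e: "expression m is w" and s: "simple (positive_word is)"
    unfolding perm_length_def
  proof (rule Least_equality[symmetric])
    fix k assume "\<exists>js. expression m js w \<and> length js = k"
    then obtain js where js: "expression m js w" "length js = k" by blast
    have "dest (positive_word js) = dest (positive_word is)" using e js by (simp add: expression_iff dest_dinv_eq_iff)
    then show "length is \<le> k"
      using length_permutation_word_le(1)[of m "positive_word is" "positive_word js"] e s js
      by (simp add: expression_iff permutation_word_def)
  qed (use e in blast)
  moreover have "simple (positive_word is)" if e: "expression m is w" and l: "length is = perm_length m w"
  proof -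
    obtain E where E: "permutation_word m E" "dest E = dest (positive_word is)"
      using exists_permutation_word[of "positive_word is" m] e by (auto simp: expression_iff)
    have eE: "positive_word (map fst E) = E" using E by (intro positive_word_fst) (simp add: permutation_word_def)
    have "dest (dinv E) = dest (dinv (positive_word is))" using E by (simp add: dest_dinv_eq_iff)
    then have "expression m (map fst E) w"
      using e E(1) unfolding expression_iff eE by (simp add: permutation_word_def)
    then have "perm_length m w \<le> length E"
      unfolding perm_length_def by (intro Least_le) auto
    then show ?thesis
      using length_permutation_word_le(2)[OF E(1), of "positive_word is"] E(2) e l by (simp add: expression_iff)
  qed
  ultimately show ?thesis
    unfolding reduced_expression_def permutation_word_def by (auto simp: expression_iff)
qed

lemma dest_permutes: "D \<in> diagrams m \<Longrightarrow> dest D permutes {1..m}"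
proof (rule bij_imp_permutes[OF bij_betw_dest])
  fix p assume D: "D \<in> diagrams m" and "p \<notin> {1..m}"
  then show "dest D p = p"
  proof (induction D arbitrary: p)
    case (Cons c D)
    then show ?case by (cases c) (auto simp: transpose_def)
  qed simp
qed

text \<open>Undoing the image of the last point leaves a permutation of \<open>{1..m}\<close>; the
  path \<open>from_last\<close> then takes the last strand to its target.\<close>

lemma permutes_dest: "w permutes {1..m} \<Longrightarrow> \<exists>D. permutation_word m D \<and> dest D = w"
proof (induction m arbitrary: w)
  case 0
  then have "w = id" by simp
  then show ?case by (intro exI[of _ "[]"]) (simp add: permutation_word_def fun_eq_iff)
next
  case (Suc m)
  define q where "q = w (Suc m)"
  have q: "q \<in> {1..Suc m}" using permutes_in_image[OF Suc.prems, of "Suc m"] by (simp add: q_def)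
  have Nil: "permutation_word m []" by (simp add: permutation_word_def)
  have from_last: "from_last q m \<in> diagrams (Suc m)" "dest (from_last q m) (Suc m) = q"
    using permutation_word_from_last(2)[OF Nil, of q] q by (auto simp: from_last_diagrams)
  define v where "v = dest (dinv (from_last q m)) \<circ> w"
  have "dest (dinv (from_last q m)) permutes {1..Suc m}" using from_last(1) by (intro dest_permutes) simp
  then have v: "v permutes {1..Suc m}" unfolding v_def by (rule permutes_compose[OF Suc.prems])
  have top: "v (Suc m) = Suc m"
    using dest_dinv1[of "from_last q m" "Suc m"] unfolding from_last(2) by (simp add: v_def q_def)
  from v have "v permutes {1..m}"
    by (rule permutes_superset) (use top in \<open>auto simp: le_Suc_eq\<close>)
  then obtain D where D: "permutation_word m D" "dest D = v" using Suc.IH by blast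
  have "dest (D @ from_last q m) = w" using D by (simp add: fun_eq_iff v_def)
  then show ?case using permutation_word_from_last(1)[OF D(1), of q] q by auto
qed

lemma positive_lifts_eq: "positive_lifts m = braid_of m ` {D. permutation_word m D}"
proof
  show "positive_lifts m \<subseteq> braid_of m ` {D. permutation_word m D}"
    by (auto simp: positive_lifts_def reduced_expression_iff word_prod_braid permutation_word_def)
  show "braid_of m ` {D. permutation_word m D} \<subseteq> positive_lifts m"
  proof
    fix b assume "b \<in> braid_of m ` {D. permutation_word m D}"
    then obtain D where D: "permutation_word m D" "b = braid_of m D" by blast
    define js where "js = map fst D"
    have js: "positive_word js = D" using D by (simp add: js_def positive_word_fst permutation_word_def)
    have "set js \<subseteq> {1..<m}" using D js positive_word_diagrams[of js m] by (simp add: permutation_word_def)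
    then have "b = word_prod (braid_group m) (sigma m) js" by (simp add: word_prod_braid js D)
    moreover have "reduced_expression m js (dest (dinv D))"
      using D js by (simp add: reduced_expression_iff)
    moreover have "dest (dinv D) \<in> carrier (sym_group m)"
      using D dest_permutes[of "dinv D" m] by (simp add: sym_group_def permutation_word_def)
    ultimately show "b \<in> positive_lifts m" unfolding positive_lifts_def by blast
  qed
qed

section \<open>The longest element\<close>

lemma half_twist_length:
  assumes T: "permutation_word m T" "half_twist m T" and D: "permutation_word m D"
  shows "length D \<le> length T" and "length T \<le> length D \<Longrightarrow> half_twist m D"
proof -
  have dT: "T \<in> diagrams m" and dD: "D \<in> diagrams m" using T D by (simp_all add: permutation_word_def)
  have le: "crossings p q D \<le> crossings p q T" for p q
    using D simple_crossings_le[of D p q] crossings_outside[OF dD, of p q]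
    by (auto simp: half_twist_crossings[OF T] permutation_word_def)
  let ?I = "{1..m} \<times> {1..m}"
  have sum: "(\<Sum>(p, q)\<in>?I. crossings p q D) \<le> (\<Sum>(p, q)\<in>?I. crossings p q T)"
    using le by (intro sum_mono) auto
  then show "length D \<le> length T" using length_sum_crossings[OF dD] length_sum_crossings[OF dT] by linarith
  assume "length T \<le> length D"
  then have eq: "(\<Sum>(p, q)\<in>?I. crossings p q D) = (\<Sum>(p, q)\<in>?I. crossings p q T)"
    using length_sum_crossings[OF dD] length_sum_crossings[OF dT] sum by linarith
  show "half_twist m D" unfolding half_twist_def
  proof (intro ballI impI)
    fix p q assume I: "p \<in> {1..m}" "q \<in> {1..m}" "p \<noteq> q"
    then have pq: "(p, q) \<in> ?I" by simp
    have "(case (p, q) of (p, q) \<Rightarrow> crossings p q D) = (case (p, q) of (p, q) \<Rightarrow> crossings p q T)"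
      by (rule sum_mono_inv[OF eq _ pq]) (use le in auto)
    then show "crossings p q D \<noteq> 0" using I by (simp add: half_twist_crossings[OF T])
  qed
qed

text \<open>A half twist has the greatest length of all permutation words, and a permutation word of
  that length is a half twist. So the reduced word chosen for the longest element is one.\<close>

lemma Delta_half_twist: "\<exists>T. permutation_word m T \<and> half_twist m T \<and> Delta m = braid_of m T"
proof -
  have Nil: "permutation_word m []" by (simp add: permutation_word_def)
  obtain T where T: "permutation_word m T" "half_twist m T" using left_complement[OF Nil] by auto
  have exp: "\<exists>D. permutation_word m D \<and> reduced_expression m (map fst D) w \<and>
      perm_length m w = length D" if "w \<in> carrier (sym_group m)" for w
  proof -
    have "w permutes {1..m}" using that by (simp add: sym_group_def)
    then obtain E where E: "permutation_word m E" "dest E = w" using permutes_dest by blast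
    \<comment> \<open>An expression of \<open>w\<close> has the inverse of \<open>w\<close> as
      strand permutation; reversal corrects the direction.\<close>
    define D where "D = rev E"
    have D: "permutation_word m D" using E(1) by (simp add: D_def permutation_word_rev)
    have "dest D = dest (dinv E)" by (simp add: D_def dest_rev fun_eq_iff)
    then have "dest (dinv D) = w" using dest_dinv_eq_iff[of D "dinv E"] E(2) by simp
    then have red: "reduced_expression m (map fst D) w"
      using D positive_word_fst[of D] by (simp add: reduced_expression_iff permutation_word_def)
    then have "perm_length m w = length D" by (simp add: reduced_expression_def)
    then show ?thesis using D red by blast
  qed
  let ?w0 = "dest (dinv T)"
  have w0: "?w0 \<in> carrier (sym_group m)"
    using T dest_permutes[of "dinv T" m] by (simp add: sym_group_def permutation_word_def)
  have "reduced_expression m (map fst T) ?w0"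
    using T positive_word_fst[of T] by (simp add: reduced_expression_iff permutation_word_def)
  then have l0: "perm_length m ?w0 = length T" by (simp add: reduced_expression_def)
  let ?L = "longest_element m"
  \<comment> \<open>The half twist bounds all lengths, which guarantees that the maximum defining
    \<open>longest_element\<close> is attained.\<close>
  have bound: "\<forall>w. w \<in> carrier (sym_group m) \<longrightarrow> perm_length m w < Suc (length T)"
    using exp half_twist_length(1)[OF T] by (metis le_imp_less_Suc)
  have L: "?L \<in> carrier (sym_group m)" "length T \<le> perm_length m ?L"
    using arg_max_nat_lemma[where P = "\<lambda>w. w \<in> carrier (sym_group m)", OF w0 bound]
      w0 l0[symmetric] by (auto simp: longest_element_def)
  define js where "js = (SOME is. reduced_expression m is ?L)"
  have red: "reduced_expression m js ?L"
  proof -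
    have "\<exists>is. reduced_expression m is ?L" using exp[OF L(1)] by blast
    then show ?thesis unfolding js_def by (rule someI_ex)
  qed
  then have pw: "permutation_word m (positive_word js)" by (simp add: reduced_expression_iff)
  have "length T \<le> length (positive_word js)" using red L(2) by (simp add: reduced_expression_def)
  then have "half_twist m (positive_word js)" by (rule half_twist_length(2)[OF T pw])
  moreover have "Delta m = braid_of m (positive_word js)"
    using pw unfolding Delta_def lift_def js_def[symmetric]
    by (simp add: word_prod_braid permutation_word_def)
  ultimately show ?thesis using pw by blast
qed

section \<open>Divisors of the full twist\<close>

lemma adj_mono: "p < q \<Longrightarrow> \<not> (p = i \<and> q = Suc i) \<Longrightarrow> adj i p < adj i q"
  by (auto simp: transpose_def)

text \<open>The strand \<open>y\<close> starts between the other two and meets neither, so it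
  separates them throughout.\<close>

lemma uncrossed_between:
  "x < y \<Longrightarrow> y < z \<Longrightarrow> crossings x y D = 0 \<Longrightarrow> crossings y z D = 0 \<Longrightarrow> crossings x z D = 0"
proof (induction D arbitrary: x y z)
  case (Cons c D)
  obtain i e where c: "c = (i, e)" by force
  have xy: "\<not> (x = i \<and> y = Suc i)" "crossings (adj i x) (adj i y) D = 0"
    and yz: "\<not> (y = i \<and> z = Suc i)" "crossings (adj i y) (adj i z) D = 0"
    using Cons.prems by (auto simp: c crossings_Cons split: if_splits)
  have "crossings (adj i x) (adj i z) D = 0"
    by (rule Cons.IH[OF adj_mono[OF Cons.prems(1) xy(1)] adj_mono[OF Cons.prems(2) yz(1)] xy(2) yz(2)])
  then show ?case using Cons.prems(1,2) by (simp add: c crossings_Cons)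
qed simp

text \<open>While the order \<open>b < p < q < a\<close> lasts, the only crossings possible among
  the four strands are \<open>b\<close> with \<open>p\<close> and \<open>q\<close> with
  \<open>a\<close>. After the first of these, say \<open>q\<close> with \<open>a\<close>, the strand
  \<open>a\<close> separates \<open>b\<close> from \<open>q\<close> for good, so these never cross.
  The other case is symmetric.\<close>

lemma four_strands:
  assumes "b < p" "p < q" "q < a"
    and "crossings p q D = 0" "crossings a b D = 0" "crossings b p D = 1" "crossings q a D = 1"
    and "crossings p a D \<noteq> 0" "crossings b q D \<noteq> 0"
  shows False
  using assms
proof (induction D arbitrary: a b p q)
  case (Cons c D)
  obtain i e where c: "c = (i, e)" by force
  note prems = Cons.prems[unfolded c crossings_Cons]
  have pq: "\<not> (p = i \<and> q = Suc i)" "crossings (adj i p) (adj i q) D = 0"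
    and ab: "crossings (adj i a) (adj i b) D = 0"
    using prems by (auto split: if_splits)
  have pa: "crossings (adj i p) (adj i a) D \<noteq> 0" and bq: "crossings (adj i b) (adj i q) D \<noteq> 0"
    using prems by (auto split: if_splits)
  have pq': "adj i p < adj i q" by (rule adj_mono[OF Cons.prems(2) pq(1)])
  consider "q = i \<and> a = Suc i" | "b = i \<and> p = Suc i" | "\<not> (q = i \<and> a = Suc i)" "\<not> (b = i \<and> p = Suc i)"
    by blast
  then show ?case
  proof cases
    case 1
    have "adj i b < adj i a" "adj i a < adj i q"
      using 1 Cons.prems(1-3) by (auto simp: transpose_def)
    moreover have "crossings (adj i a) (adj i q) D = 0" using prems(7) 1 by (simp add: crossings_commute)
    ultimately have "crossings (adj i b) (adj i q) D = 0"
      using uncrossed_between[of "adj i b" "adj i a" "adj i q" D] ab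
      by (simp add: crossings_commute[of "adj i b" "adj i a"])
    then show False using bq by simp
  next
    case 2
    have "adj i p < adj i b" "adj i b < adj i a"
      using 2 Cons.prems(1-3) by (auto simp: transpose_def)
    moreover have "crossings (adj i p) (adj i b) D = 0" using prems(6) 2 by (simp add: crossings_commute)
    ultimately have "crossings (adj i p) (adj i a) D = 0"
      using uncrossed_between[of "adj i p" "adj i b" "adj i a" D] ab
      by (simp add: crossings_commute[of "adj i b" "adj i a"])
    then show False using pa by simp
  next
    case 3
    have "crossings (adj i b) (adj i p) D = 1" "crossings (adj i q) (adj i a) D = 1"
      using prems 3 by (auto split: if_splits)
    moreover have "adj i b < adj i p" "adj i q < adj i a"
      using Cons.prems(1,3) 3 by (auto intro: adj_mono)
    ultimately show False using Cons.IH[of "adj i b" "adj i p" "adj i q" "adj i a"] pq' pq ab pa bq by blast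
  qed
qed simp

text \<open>
  The assumption \<open>weighted\<close> says that no crossing at the top of \<open>V\<close> can be moved up into \<open>U\<close>, and
  \<open>C\<close> is what remains of a full twist.
\<close>

lemma left_weighted_snoc:
  assumes U: "simple U" and V: "simple V"
    and two: "\<And>p q. p \<in> {1..m} \<Longrightarrow> q \<in> {1..m} \<Longrightarrow> p \<noteq> q \<Longrightarrow> crossings p q (U @ V @ (i, True) # C) = 2"
    and dU: "U \<in> diagrams m" and dV: "V \<in> diagrams m" and i: "i \<in> {1..<m}"
    and weighted: "\<And>j. j \<in> {1..<m} \<Longrightarrow> crossings j (Suc j) V \<noteq> 0 \<Longrightarrow>
      crossings (dest (dinv U) j) (dest (dinv U) (Suc j)) U \<noteq> 0"
  shows "simple (V @ [(i, True)])"
proof (rule ccontr)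
  assume not_simple: "\<not> simple (V @ [(i, True)])"
  txt \<open>Strands are named by their position between \<^term>\<open>U\<close> and \<^term>\<open>V\<close>.\<close>
  define t where "t p = dest (dinv U) p" for p
  define b where "b p = adj i (dest V p)" for p
  define u where "u p q = crossings (t p) (t q) U" for p q
  define v where "v p q = crossings p q V" for p q
  define w where "w p q = crossings (b p) (b q) C" for p q
  have t_mem: "t p \<in> {1..m}" if "p \<in> {1..m}" for p
    using that dest_mem[of "dinv U" m p] dU by (simp add: t_def)
  have t_inj: "t p \<noteq> t q" if "p \<noteq> q" for p q using that by (simp add: t_def)
  have comm: "u p q = u q p" "v p q = v q p" "w p q = w q p" for p q
    by (simp_all add: u_def v_def w_def crossings_commute)
  have le1: "u p q \<le> 1" "v p q \<le> 1" for p q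
    using simple_crossings_le[OF U] simple_crossings_le[OF V] by (simp_all add: u_def v_def)
  have u_iff: "u p q = 0 \<longleftrightarrow> t p < t q" if "p < q" for p q
    using simple_crossings_iff[OF U, of "t p" "t q"] t_inj[of p q] that by (simp add: u_def t_def)
  have v_iff: "v p q = 0 \<longleftrightarrow> dest V p < dest V q" if "p < q" for p q
    using simple_crossings_iff[OF V, of p q] that by (simp add: v_def)
  have between: "w p r = 0" if "b p < b q" "b q < b r" "w p q = 0" "w q r = 0" for p q r
    using uncrossed_between[of "b p" "b q" "b r" C] that by (simp add: w_def)
  \<comment> \<open>\<open>x\<close> and \<open>y\<close> are the strands of the added crossing. If
    it does not fit, they already cross in \<open>V\<close>, and the total of two leaves them no
    crossing in \<open>U\<close> and \<open>C\<close>.\<close>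
  define x where "x = dest (dinv V) (Suc i)"
  define y where "y = dest (dinv V) i"
  have Vx: "dest V x = Suc i" and Vy: "dest V y = i"
    unfolding x_def y_def by (simp_all only: dest_dinv2)
  have Vx_iff: "dest V p = Suc i \<longleftrightarrow> p = x" and Vy_iff: "dest V p = i \<longleftrightarrow> p = y" for p
    using dest_inj[of V p x, unfolded Vx] dest_inj[of V p y, unfolded Vy] by simp_all
  have total: "u p q + v p q + (if p = x \<and> q = y \<or> p = y \<and> q = x then 1 else 0) + w p q = 2"
    if "p \<in> {1..m}" "q \<in> {1..m}" "p \<noteq> q" for p q
  proof -
    have "crossings (t p) (t q) (U @ V @ (i, True) # C) = 2"
      by (rule two[OF t_mem[OF that(1)] t_mem[OF that(2)] t_inj[OF that(3)]])
    moreover have "dest U (t r) = r" for r by (simp add: t_def)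
    ultimately show ?thesis
      by (auto simp: crossings_append crossings_Cons u_def v_def w_def b_def Vx_iff Vy_iff)
  qed
  have xm: "x \<in> {1..m}" and ym: "y \<in> {1..m}"
    using dest_mem[of "dinv V" m i] dest_mem[of "dinv V" m "Suc i"] dV i by (auto simp: x_def y_def)
  have vxy: "v x y = 1"
    using not_simple V le1(2)[of y x] by (simp add: simple_snoc v_def x_def y_def comm(2) crossings_commute)
  have xy: "x < y"
  proof (rule ccontr)
    assume "\<not> x < y"
    moreover have "x \<noteq> y" using Vx Vy by auto
    ultimately have "y < x" by simp
    then show False using v_iff[of y x] vxy comm(2)[of x y] Vx Vy by simp
  qed
  have uxy: "u x y = 0" and wxy: "w x y = 0" using total[OF xm ym] xy vxy by auto
  have txy: "t x < t y" using u_iff[OF xy] uxy by simp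
  have bx: "b x = i" and b_y: "b y = Suc i" by (simp_all add: b_def Vx Vy)
  have b_less: "b p = dest V p" if "dest V p < i \<or> Suc i < dest V p" for p
    using that by (auto simp: b_def transpose_def)
  \<comment> \<open>From \<open>x\<close> to \<open>y\<close> the endpoints in \<open>V\<close> pass
    from \<open>Suc i\<close> to \<open>i\<close>, so some neighbouring pair drops from at least
    \<open>Suc i\<close> to at most \<open>i\<close>. This pair crosses in \<open>V\<close>, hence
    in \<open>U\<close> as the factors are weighted, hence not in \<open>C\<close>.\<close>
  obtain j where j: "x \<le> j" "j < y" "Suc i \<le> dest V j" "dest V (Suc j) \<le> i"
  proof -
    have "\<exists>j. x \<le> j \<and> j < y \<and> Suc i \<le> dest V j \<and> \<not> Suc i \<le> dest V (Suc j)"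
    proof (rule ccontr)
      assume none: "\<not> ?thesis"
      have "y' \<le> y \<Longrightarrow> Suc i \<le> dest V y'" if "x \<le> y'" for y'
        using that
      proof (induction y' rule: dec_induct)
        case base
        then show ?case by (simp add: Vx)
      next
        case (step k)
        then show ?case using none by auto
      qed
      from this[of y] show False using xy Vy by simp
    qed
    then show ?thesis using that by auto
  qed
  have jm: "j \<in> {1..<m}" "j \<in> {1..m}" "Suc j \<in> {1..m}" using j xm ym by auto
  have vj: "v j (Suc j) = 1" using v_iff[of j "Suc j"] le1(2)[of j "Suc j"] j by simp
  have uj: "u j (Suc j) = 1"
    using weighted[OF jm(1)] vj le1(1)[of j "Suc j"] by (simp add: u_def v_def t_def)
  have wj: "w j (Suc j) = 0" using total[OF jm(2,3)] uj vj by simp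
  have tj: "t (Suc j) < t j" using u_iff[of j "Suc j"] uj t_inj[of j "Suc j"] by simp
  have not_xy: "\<not> (j = x \<and> Suc j = y)" using uj uxy by auto
  have left: "dest V (Suc j) < i" "b (Suc j) = dest V (Suc j)" if "Suc j \<noteq> y"
    using that j(4) Vy_iff[of "Suc j"] b_less[of "Suc j"] by auto
  have right: "Suc i < dest V j" "b j = dest V j" if "j \<noteq> x"
    using that j(3) Vx_iff[of j] b_less[of j] by auto
  \<comment> \<open>Without crossings in \<open>U\<close> and \<open>V\<close>, both crossings of
    the pair are left for \<open>C\<close>.\<close>
  have left_two: "w (Suc j) y = 2" if "Suc j \<noteq> y" "t (Suc j) < t y"
  proof -
    have "Suc j < y" using that(1) j(2) by simp
    then have "u (Suc j) y = 0" "v (Suc j) y = 0"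
      using u_iff[of "Suc j" y] v_iff[of "Suc j" y] that left Vy by simp_all
    then show ?thesis using total[OF jm(3) ym that(1)] that(1) j(1) by auto
  qed
  have right_two: "w x j = 2" if "j \<noteq> x" "t x < t j"
  proof -
    have "x < j" using that(1) j(1) by simp
    then have "u x j = 0" "v x j = 0"
      using u_iff[of x j] v_iff[of x j] that right Vx by simp_all
    then show ?thesis using total[OF xm jm(2)] \<open>x < j\<close> j(2) by auto
  qed
  \<comment> \<open>Otherwise \<open>x\<close>, which does not cross \<open>y\<close> in
    \<open>C\<close> either, would separate \<open>Suc j\<close> from \<open>y\<close>, contrary to
    \<open>left_two\<close>.\<close>
  have left_contra: "w (Suc j) x \<noteq> 0" if "Suc j \<noteq> y" "t (Suc j) < t y"
    using between[of "Suc j" x y] left_two[OF that] left[OF that(1)] bx b_y wxy by auto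
  have right_contra: "w y j \<noteq> 0" if "j \<noteq> x" "t x < t j"
    using between[of x y j] right_two[OF that] right[OF that(1)] bx b_y wxy by auto
  consider "j = x" | "Suc j = y" | "j \<noteq> x" "Suc j \<noteq> y" by blast
  then show False
  proof cases
    case 1
    then have "Suc j \<noteq> y" "t (Suc j) < t y" using not_xy tj txy by auto
    then show False using left_contra wj 1 comm(3)[of x "Suc j"] by simp
  next
    case 2
    then have "j \<noteq> x" "t x < t j" using not_xy tj txy by auto
    then show False using right_contra wj 2 comm(3)[of j y] by simp
  next
    \<comment> \<open>The four strands enter \<open>C\<close> in the order \<open>Suc j\<close>,
      \<open>x\<close>, \<open>y\<close>, \<open>j\<close>, and the counts left for them are those
      excluded by \<open>four_strands\<close>.\<close>
    case 3
    have less: "x < j" "Suc j < y" using 3 j by auto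
    have vB: "v x (Suc j) = 1"
      using v_iff[of x "Suc j"] le1(2)[of x "Suc j"] left[OF 3(2)] less Vx by simp
    have vA: "v j y = 1"
      using v_iff[of j y] le1(2)[of j y] right[OF 3(1)] less Vy by simp
    have totB: "u x (Suc j) + w x (Suc j) = 1"
      using total[OF xm jm(3)] less vB by auto
    have totA: "u j y + w j y = 1"
      using total[OF jm(2) ym] less vA by auto
    have uB: "u x (Suc j) = 0"
    proof (rule ccontr)
      assume u1: "u x (Suc j) \<noteq> 0"
      then have "t (Suc j) < t x" using u_iff[of x "Suc j"] t_inj[of x "Suc j"] less by simp
      then show False using left_contra[OF 3(2)] txy totB u1 comm(3)[of x "Suc j"] by simp
    qed
    have uA: "u j y = 0"
    proof (rule ccontr)
      assume u1: "u j y \<noteq> 0"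
      then have "t y < t j" using u_iff[of j y] t_inj[of j y] less by simp
      then show False using right_contra[OF 3(1)] txy totA u1 comm(3)[of j y] by simp
    qed
    have ts: "t x < t (Suc j)" "t j < t y"
      using u_iff[of x "Suc j"] u_iff[of j y] uA uB less by simp_all
    have "w (Suc j) y = 2" "w x j = 2"
      using left_two[OF 3(2)] right_two[OF 3(1)] ts tj by simp_all
    moreover have "w (Suc j) x = 1" "w y j = 1"
      using totA totB uA uB comm(3)[of x "Suc j"] comm(3)[of j y] by simp_all
    moreover have "b (Suc j) < b x" "b x < b y" "b y < b j"
      using left[OF 3(2)] right[OF 3(1)] bx b_y by simp_all
    ultimately show False
      using four_strands[of "b (Suc j)" "b x" "b y" "b j" C] wxy wj by (simp add: w_def)
  qed
qed

section \<open>Factoring positive divisors of the full twist\<close>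

lemma permutation_word_snoc:
  "permutation_word m (D @ [(i, True)]) \<longleftrightarrow> permutation_word m D \<and> i \<in> {1..<m} \<and>
    crossings (dest (dinv D) i) (dest (dinv D) (Suc i)) D = 0"
  by (auto simp: permutation_word_def simple_snoc)

text \<open>A crossing at the top of the second factor is moved to the end of the first as long as
  the first stays a permutation word. The second factor gets shorter each time.\<close>

lemma left_weighted_factorization:
  assumes "permutation_word m X" "permutation_word m Y"
  shows "\<exists>U V. permutation_word m U \<and> permutation_word m V \<and> (X @ Y, U @ V) \<in> braid_rel m \<and>
    (\<forall>j\<in>{1..<m}. crossings j (Suc j) V \<noteq> 0 \<longrightarrow> crossings (dest (dinv U) j) (dest (dinv U) (Suc j)) U \<noteq> 0)"
  using assms
proof (induction "length Y" arbitrary: X Y rule: less_induct)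
  case less
  show ?case
  proof (cases "\<forall>j\<in>{1..<m}. crossings j (Suc j) Y \<noteq> 0 \<longrightarrow> crossings (dest (dinv X) j) (dest (dinv X) (Suc j)) X \<noteq> 0")
    case True
    have "(X @ Y, X @ Y) \<in> braid_rel m"
      using less.prems by (intro braid_rel.refl) (simp add: permutation_word_def)
    then show ?thesis using True less.prems by blast
  next
    case False
    then obtain j where j: "j \<in> {1..<m}" "crossings j (Suc j) Y \<noteq> 0"
      "crossings (dest (dinv X) j) (dest (dinv X) (Suc j)) X = 0" by blast
    obtain Z where Z: "permutation_word m Z" "((j, True) # Z, Y) \<in> braid_rel m"
      using exchange[OF less.prems(2) j(2)] by blast
    have len: "length Z < length Y"
      using length_rel_positive[OF Z(2)] Z(1) less.prems(2) by (simp add: permutation_word_def)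
    have "permutation_word m (X @ [(j, True)])"
      using less.prems j by (simp add: permutation_word_snoc)
    from less.hyps[OF len this Z(1)] obtain U V where UV: "permutation_word m U" "permutation_word m V"
      "((X @ [(j, True)]) @ Z, U @ V) \<in> braid_rel m"
      "\<forall>j\<in>{1..<m}. crossings j (Suc j) V \<noteq> 0 \<longrightarrow> crossings (dest (dinv U) j) (dest (dinv U) (Suc j)) U \<noteq> 0"
      by blast
    have "(X @ Y, X @ (j, True) # Z) \<in> braid_rel m"
      using braid_rel_ctxt2(1)[OF braid_rel.sym[OF Z(2)]] less.prems by (simp add: permutation_word_def)
    then have "(X @ Y, U @ V) \<in> braid_rel m" using UV(3) by (simp add: braid_rel.trans)
    then show ?thesis using UV by blast
  qed
qed

text \<open>The word is built up letter by letter, the letters still to come being part of the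
  complement \<open>C\<close>. Before each new letter the factors are made left-weighted; then it
  fits into the second factor by \<open>left_weighted_snoc\<close>.\<close>

lemma two_factors:
  "A \<in> diagrams m \<Longrightarrow> positive A \<Longrightarrow> C \<in> diagrams m \<Longrightarrow> positive C \<Longrightarrow>
    (\<And>p q. p \<in> {1..m} \<Longrightarrow> q \<in> {1..m} \<Longrightarrow> p \<noteq> q \<Longrightarrow> crossings p q (A @ C) = 2) \<Longrightarrow>
    \<exists>X Y. permutation_word m X \<and> permutation_word m Y \<and> (A, X @ Y) \<in> braid_rel m"
proof (induction A arbitrary: C rule: rev_induct)
  case Nil
  have "permutation_word m []" "([], [] @ []) \<in> braid_rel m"
    by (simp_all add: permutation_word_def braid_rel.refl)
  then show ?case by blast
next
  case (snoc c A)
  obtain i where c: "c = (i, True)" using snoc.prems(2) by (cases c) auto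
  have i: "i \<in> {1..<m}" and A: "A \<in> diagrams m" "positive A" using snoc.prems by (auto simp: c)
  have "(i, True) # C \<in> diagrams m" "positive ((i, True) # C)" using i snoc.prems by auto
  moreover have "crossings p q (A @ (i, True) # C) = 2" if "p \<in> {1..m}" "q \<in> {1..m}" "p \<noteq> q" for p q
    using snoc.prems(5)[OF that] by (simp add: c)
  ultimately obtain X Y where XY: "permutation_word m X" "permutation_word m Y" "(A, X @ Y) \<in> braid_rel m"
    using snoc.IH[OF A] by blast
  then obtain U V where UV: "permutation_word m U" "permutation_word m V" "(X @ Y, U @ V) \<in> braid_rel m"
    and weighted: "\<forall>j\<in>{1..<m}. crossings j (Suc j) V \<noteq> 0 \<longrightarrow>
      crossings (dest (dinv U) j) (dest (dinv U) (Suc j)) U \<noteq> 0"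
    using left_weighted_factorization by blast
  have AUV: "(A, U @ V) \<in> braid_rel m" using XY(3) UV(3) by (rule braid_rel.trans)
  have rel: "(A @ (i, True) # C, U @ V @ (i, True) # C) \<in> braid_rel m"
    using braid_rel_ctxt2(2)[OF AUV, of "(i, True) # C"] i snoc.prems by simp
  have "simple (V @ [(i, True)])"
  proof (rule left_weighted_snoc[where U = U and m = m and C = C])
    fix p q assume "p \<in> {1..m}" "q \<in> {1..m}" "p \<noteq> q"
    then have "crossings p q (A @ (i, True) # C) = 2" using snoc.prems(5) by (simp add: c)
    then show "crossings p q (U @ V @ (i, True) # C) = 2"
      using crossings_rel_positive[OF rel] A snoc.prems UV by (simp add: permutation_word_def)
  qed (use UV weighted i in \<open>auto simp: permutation_word_def\<close>)
  then have "permutation_word m (V @ [(i, True)])"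
    using UV(2) i by (simp add: permutation_word_def)
  moreover have "(A @ [c], U @ V @ [(i, True)]) \<in> braid_rel m"
    using braid_rel_ctxt2(2)[OF AUV, of "[(i, True)]"] i by (simp add: c)
  ultimately show ?case using UV(1) by blast
qed

section \<open>Rational permutation braids\<close>

lemma braid_group_inv:
  assumes "u \<in> diagrams m"
  shows "inv\<^bsub>braid_group m\<^esub> (braid_of m u) = braid_of m (dinv u)"
proof -
  interpret group "braid_group m" by (rule group_braid_group)
  have "braid_of m (dinv u) \<otimes>\<^bsub>braid_group m\<^esub> braid_of m u = \<one>\<^bsub>braid_group m\<^esub>"
    using assms braid_of_eqI[OF braid_rel_dinv_left[OF assms]]
    by (simp add: braid_group_mult) (simp add: braid_group_def)
  then show ?thesis using assms by (intro inv_equality) (auto simp: braid_group_carrier)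
qed

lemma braid_of_eq_iff: "u \<in> diagrams m \<Longrightarrow> v \<in> diagrams m \<Longrightarrow>
    braid_of m u = braid_of m v \<longleftrightarrow> (u, v) \<in> braid_rel m"
  unfolding braid_of_def by (rule eq_equiv_class_iff[OF equiv_braid_rel])

lemma positive_monoid_eq: "positive_monoid m = braid_of m ` {D \<in> diagrams m. positive D}"
proof
  show "positive_monoid m \<subseteq> braid_of m ` {D \<in> diagrams m. positive D}"
  proof
    fix a assume "a \<in> positive_monoid m"
    then show "a \<in> braid_of m ` {D \<in> diagrams m. positive D}"
    proof induction
      case one
      then show ?case by (auto simp: braid_group_def intro!: image_eqI[of _ _ "[]"])
    next
      case (gen i)
      then show ?case by (auto simp: sigma_def intro!: image_eqI[of _ _ "[(i, True)]"])
    next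
      case (mult a b)
      then obtain D E where "D \<in> diagrams m" "positive D" "a = braid_of m D"
        "E \<in> diagrams m" "positive E" "b = braid_of m E" by blast
      then show ?case by (auto simp: braid_group_mult intro!: image_eqI[of _ _ "D @ E"])
    qed
  qed
  have "braid_of m D \<in> positive_monoid m" if "D \<in> diagrams m" "positive D" for D
    using that
  proof (induction D)
    case Nil
    then show ?case using positive_monoid.one[of m] by (simp add: braid_group_def)
  next
    case (Cons c D)
    obtain i where c: "c = (i, True)" using Cons.prems by (cases c) auto
    have "sigma m i \<otimes>\<^bsub>braid_group m\<^esub> braid_of m D \<in> positive_monoid m"
      using Cons c by (intro positive_monoid.mult positive_monoid.gen) auto
    then show ?case using Cons.prems braid_group_mult[of "[(i, True)]" m D] by (simp add: sigma_def c)
  qed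
  then show "braid_of m ` {D \<in> diagrams m. positive D} \<subseteq> positive_monoid m" by blast
qed

lemma positive_monoid_iff:
  assumes "u \<in> diagrams m"
  shows "braid_of m u \<in> positive_monoid m \<longleftrightarrow> (\<exists>D. positive D \<and> (u, D) \<in> braid_rel m)"
proof -
  have "braid_of m u \<in> positive_monoid m \<longleftrightarrow>
      (\<exists>D\<in>diagrams m. positive D \<and> braid_of m u = braid_of m D)"
    unfolding positive_monoid_eq by blast
  then show ?thesis using assms braid_of_eq_iff[OF assms] braid_rel_diagrams by metis
qed

lemma rational_iff_words:
  assumes B: "B \<in> diagrams m" and T: "T \<in> diagrams m" "Delta m = braid_of m T"
  shows "rational_permutation_braid m (braid_of m B) \<longleftrightarrow>
    (\<exists>D. positive D \<and> (T @ B, D) \<in> braid_rel m) \<and>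
    (\<exists>D. positive D \<and> (dinv B @ T, D) \<in> braid_rel m)"
proof -
  have "left_divides m (inv\<^bsub>braid_group m\<^esub> Delta m) (braid_of m B) \<longleftrightarrow>
      braid_of m (T @ B) \<in> positive_monoid m"
    using assms by (simp add: left_divides_def braid_group_inv braid_group_mult)
  moreover have "left_divides m (braid_of m B) (Delta m) \<longleftrightarrow>
      braid_of m (dinv B @ T) \<in> positive_monoid m"
    using assms by (simp add: left_divides_def braid_group_inv braid_group_mult)
  moreover have "braid_of m B \<in> carrier (braid_group m)" using B by (simp add: braid_group_carrier)
  ultimately show ?thesis
    using B T(1) by (simp add: rational_permutation_braid_def positive_monoid_iff)
qed

text \<open>Permutation braids divide \<open>\<Delta>\<close> on both sides. With
  \<open>\<Delta> = Z X\<close> the first product becomes \<open>Z Y\<close>. For the second,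
  \<open>\<Delta> = X X1 = X1 X2\<close> gives \<open>X \<Delta> = \<Delta> X2\<close>, and
  \<open>\<Delta> = Y Y1\<close> absorbs the inverse of \<open>Y\<close>.\<close>

lemma rational_fraction:
  assumes X: "permutation_word m X" and Y: "permutation_word m Y"
  shows "rational_permutation_braid m (braid_of m (dinv X @ Y))"
proof -
  obtain T where T: "permutation_word m T" "half_twist m T" "Delta m = braid_of m T"
    using Delta_half_twist by blast
  obtain Z where Z: "permutation_word m (Z @ X)" "half_twist m (Z @ X)" using left_complement[OF X] by blast
  obtain Y1 where Y1: "permutation_word m (Y @ Y1)" "half_twist m (Y @ Y1)"
    using right_complement[OF Y] by blast
  obtain X1 where X1: "permutation_word m (X @ X1)" "half_twist m (X @ X1)"
    using right_complement[OF X] by blast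
  have pX1: "permutation_word m X1" using permutation_word_append[OF X1(1)] by simp
  obtain X2 where X2: "permutation_word m (X1 @ X2)" "half_twist m (X1 @ X2)"
    using right_complement[OF pX1] by blast
  have d: "X \<in> diagrams m" "Y \<in> diagrams m" "Z \<in> diagrams m" "T \<in> diagrams m"
      "Y1 \<in> diagrams m" "X1 \<in> diagrams m" "X2 \<in> diagrams m"
    and pos: "positive Z" "positive Y" "positive Y1" "positive X2"
    using X Y T Z Y1 X1 X2 by (auto simp: permutation_word_def)
  have TZ: "(T, Z @ X) \<in> braid_rel m" by (rule half_twist_unique[OF T(1,2) Z])
  have TX: "(T, X1 @ X2) \<in> braid_rel m" by (rule half_twist_unique[OF T(1,2) X2])
  have XT: "(X @ X1, T) \<in> braid_rel m" by (rule half_twist_unique[OF X1 T(1,2)])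
  have TY: "(T, Y @ Y1) \<in> braid_rel m" by (rule half_twist_unique[OF T(1,2) Y1])
  have "(T @ dinv X @ Y, (Z @ X) @ dinv X @ Y) \<in> braid_rel m"
    using d by (intro braid_rel_ctxt2(2)[OF TZ]) simp
  also have "((Z @ X) @ dinv X @ Y, Z @ Y) \<in> braid_rel m"
    using braid_rel_ctxt[OF braid_rel_dinv_right[OF d(1)], of Z Y] d by simp
  finally have 1: "(T @ dinv X @ Y, Z @ Y) \<in> braid_rel m" .
  have "(dinv Y @ X @ T, dinv Y @ X @ X1 @ X2) \<in> braid_rel m"
    using braid_rel_ctxt2(1)[OF TX, of "dinv Y @ X"] d by simp
  also have "(dinv Y @ X @ X1 @ X2, dinv Y @ T @ X2) \<in> braid_rel m"
    using braid_rel_ctxt[OF XT, of "dinv Y" X2] d by simp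
  also have "(dinv Y @ T @ X2, dinv Y @ Y @ Y1 @ X2) \<in> braid_rel m"
    using braid_rel_ctxt[OF TY, of "dinv Y" X2] d by simp
  also have "(dinv Y @ Y @ Y1 @ X2, Y1 @ X2) \<in> braid_rel m"
    using braid_rel_ctxt2(2)[OF braid_rel_dinv_left[OF d(2)], of "Y1 @ X2"] d by simp
  finally have 2: "(dinv (dinv X @ Y) @ T, Y1 @ X2) \<in> braid_rel m" by (simp add: dinv_append)
  have "dinv X @ Y \<in> diagrams m" "positive (Z @ Y)" "positive (Y1 @ X2)" using d pos by simp_all
  then show ?thesis using 1 2 rational_iff_words[OF _ d(4) T(3)] by blast
qed

text \<open>With \<open>\<Delta> \<beta> = U V\<close> from \<open>two_factors\<close> and
  \<open>\<Delta> = U X\<close>, cancelling \<open>U\<close> gives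
  \<open>X \<beta> = V\<close>.\<close>

lemma rational_imp_fraction:
  assumes B: "B \<in> diagrams m" and rational: "rational_permutation_braid m (braid_of m B)"
  shows "\<exists>X Y. permutation_word m X \<and> permutation_word m Y \<and> (B, dinv X @ Y) \<in> braid_rel m"
proof -
  obtain T where T: "permutation_word m T" "half_twist m T" "Delta m = braid_of m T"
    using Delta_half_twist by blast
  have dT: "T \<in> diagrams m" and pT: "positive T" using T by (simp_all add: permutation_word_def)
  obtain A C where A: "positive A" "(T @ B, A) \<in> braid_rel m"
    and C: "positive C" "(dinv B @ T, C) \<in> braid_rel m"
    using rational rational_iff_words[OF B dT T(3)] by blast
  have dA: "A \<in> diagrams m" and dC: "C \<in> diagrams m"
    using braid_rel_diagrams[OF A(2)] braid_rel_diagrams[OF C(2)] by auto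
  have "(A @ C, (T @ B) @ dinv B @ T) \<in> braid_rel m"
    by (rule braid_rel_append[OF braid_rel.sym[OF A(2)] braid_rel.sym[OF C(2)]])
  also have "((T @ B) @ dinv B @ T, T @ T) \<in> braid_rel m"
    using braid_rel_ctxt[OF braid_rel_dinv_right[OF B] dT dT] by simp
  finally have "(A @ C, T @ T) \<in> braid_rel m" .
  then have AC: "crossings p q (A @ C) = crossings p q (T @ T)" for p q
    using A C pT by (intro crossings_rel_positive) auto
  \<comment> \<open>Every pair crosses once in each of the two half twists.\<close>
  have "crossings p q (A @ C) = 2" if "p \<in> {1..m}" "q \<in> {1..m}" "p \<noteq> q" for p q
    unfolding AC unfolding crossings_append half_twist_crossings[OF T(1,2)]
    using that dest_mem[OF dT, of p] dest_mem[OF dT, of q] by simp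
  then obtain U V where UV: "permutation_word m U" "permutation_word m V" "(A, U @ V) \<in> braid_rel m"
    using two_factors[OF dA A(1) dC C(1)] by blast
  obtain X where X: "permutation_word m (U @ X)" "half_twist m (U @ X)"
    using right_complement[OF UV(1)] by blast
  have pX: "permutation_word m X" using permutation_word_append[OF X(1)] by simp
  have d: "U \<in> diagrams m" "V \<in> diagrams m" "X \<in> diagrams m"
    using UV pX by (simp_all add: permutation_word_def)
  have TU: "(T, U @ X) \<in> braid_rel m" by (rule half_twist_unique[OF T(1,2) X])
  have "(U @ X @ B, T @ B) \<in> braid_rel m"
    using braid_rel_ctxt2(2)[OF braid_rel.sym[OF TU] B] by simp
  also note A(2)
  also note UV(3)
  finally have XB: "(X @ B, V) \<in> braid_rel m" by (rule braid_rel_cancel_left)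
  have "(B, dinv X @ X @ B) \<in> braid_rel m"
    using braid_rel.sym[OF braid_rel_ctxt2(2)[OF braid_rel_dinv_left[OF d(3)] B]] by simp
  also have "(dinv X @ X @ B, dinv X @ V) \<in> braid_rel m"
    using braid_rel_ctxt2(1)[OF XB] d by simp
  finally show ?thesis using pX UV by blast
qed

theorem proposition5p7:
  fixes n :: nat and \<beta> :: braid
  assumes "\<beta> \<in> carrier (braid_group (n + 1))"
  shows "(mikado (n + 1) \<beta> \<longleftrightarrow>
            (\<exists>x \<in> positive_lifts (n + 1). \<exists>y \<in> positive_lifts (n + 1).
               \<beta> = inv\<^bsub>braid_group (n + 1)\<^esub> x \<otimes>\<^bsub>braid_group (n + 1)\<^esub> y)) \<and>
         (mikado (n + 1) \<beta> \<longleftrightarrow> rational_permutation_braid (n + 1) \<beta>)"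
proof -
  let ?m = "Suc n"
  obtain B where B: "B \<in> diagrams ?m" "\<beta> = braid_of ?m B"
    using assms by (auto simp: braid_group_carrier)
  \<comment> \<open>The common form to which all three properties are reduced.\<close>
  let ?fraction = "\<exists>X Y. permutation_word ?m X \<and> permutation_word ?m Y \<and> \<beta> = braid_of ?m (dinv X @ Y)"
  have quotient: "inv\<^bsub>braid_group ?m\<^esub> (braid_of ?m X) \<otimes>\<^bsub>braid_group ?m\<^esub> braid_of ?m Y =
      braid_of ?m (dinv X @ Y)" if "permutation_word ?m X" "permutation_word ?m Y" for X Y
    using that by (simp add: permutation_word_def braid_group_inv braid_group_mult)
  have mikado: "mikado ?m \<beta> \<longleftrightarrow> ?fraction"
    using mikado_imp_fraction[of ?m \<beta>] mikado_fraction[of n] by auto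
  have "rational_permutation_braid ?m \<beta> \<longleftrightarrow> ?fraction"
    using rational_fraction[of ?m] rational_imp_fraction[OF B(1)] braid_of_eqI B(2) by metis
  moreover have "(\<exists>x\<in>positive_lifts ?m. \<exists>y\<in>positive_lifts ?m.
      \<beta> = inv\<^bsub>braid_group ?m\<^esub> x \<otimes>\<^bsub>braid_group ?m\<^esub> y) \<longleftrightarrow> ?fraction"
    unfolding positive_lifts_eq using quotient by (auto; metis)
  ultimately show ?thesis using mikado by simp
qed

end
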